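(* Let $(A_0,A_1)$ be a quasi-Banach couple, $0<\theta<1$ and $0<q\le\infty$. Then $$A_0\cap A_1\hookrightarrow (A_0,A_1)_{\theta,q}\hookrightarrow A_0+A_1.$$ Moreover: (a) If $A_0\neq A_0+A_1$ or $A_1\neq A_0+A_1$, then $(A_0,A_1)_{\theta,q}\neq A_0+A_1$. (b) If $A_0\cap A_1$ is not closed in $A_0+A_1$, then $(A_0,A_1)_{\theta,q}\neq A_0\cap A_1$.
   Context: A quasi-Banach couple $(A_0,A_1)$ consists of two quasi-Banach spaces (complete quasi-normed spaces) continuously embedded in a common Hausdorff topological vector space. For $x\in A_0+A_1$ and $t>0$, $K(x,t)=K(x,t,A_0,A_1)=\inf\{\|a_0\|_{A_0}+t\|a_1\|_{A_1}: x=a_0+a_1,\ a_j\in A_j,\ j=0,1\}$. The sum carries the quasi-norm $\|x\|_{A_0+A_1}=K(x,1,A_0,A_1)$ and the intersection carries $\|x\|_{A_0\cap A_1}=\max\{\|x\|_{A_0},\|x\|_{A_1}\}$. The symbol $\hookrightarrow$ denotes continuous inclusion, and (in)equality of spaces is (in)equality as sets. For $0<\theta<1$ and $0<q\le\infty$, $(A_0,A_1)_{\theta,q}$ is the space of all $x\in A_0+A_1$ for which the quasi-norm $\|x\|_{(A_0,A_1)_{\theta,q}}=\left(\int_0^\infty (t^{-\theta}K(x,t))^q\frac{dt}{t}\right)^{1/q}$ if $q<\infty$, or $\sup_{0<t<\infty}t^{-\theta}K(x,t)$ if $q=\infty$, is finite. *)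

theory Defs
  imports "HOL-Analysis.Analysis"
begin

text \<open>
  Hausdorff topological vector spaces. The scalars are real; complex spaces are covered by
  restriction of scalars, since the \<open>K\<close>-functional and everything built from it only uses
  the additive structure and the quasi-norms.
\<close>

class hausdorff_tvs = real_vector + topological_ab_group_add + t2_space +
  assumes tendsto_scaleR_Pair:
    "LIM p (nhds (c::real) \<times>\<^sub>F nhds a). fst p *\<^sub>R snd p :> nhds (c *\<^sub>R a)"

instance real_normed_vector \<subseteq> hausdorff_tvs
proof
  fix c :: real and a :: 'a
  have "((\<lambda>p. fst p *\<^sub>R snd p) \<longlongrightarrow> c *\<^sub>R a) (nhds c \<times>\<^sub>F nhds a)"
    by (intro tendsto_scaleR filterlim_fst filterlim_snd)
  then show "LIM p (nhds c \<times>\<^sub>F nhds a). fst p *\<^sub>R snd p :> nhds (c *\<^sub>R a)" .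
qed

text \<open>
  A linear subspace of an ambient vector space together with a functional on it; the values of
  \<open>qnorm\<close> outside \<open>carr\<close> are irrelevant.
\<close>

record 'a qspace =
  carr :: "'a set"
  qnorm :: "'a \<Rightarrow> real"

definition quasi_normed :: "'a::real_vector qspace \<Rightarrow> bool" where
  "quasi_normed A \<longleftrightarrow>
     subspace (carr A) \<and>
     (\<forall>x\<in>carr A. 0 \<le> qnorm A x) \<and>
     (\<forall>x\<in>carr A. qnorm A x = 0 \<longleftrightarrow> x = 0) \<and>
     (\<forall>c. \<forall>x\<in>carr A. qnorm A (c *\<^sub>R x) = \<bar>c\<bar> * qnorm A x) \<and>
     (\<exists>C\<ge>1. \<forall>x\<in>carr A. \<forall>y\<in>carr A. qnorm A (x + y) \<le> C * (qnorm A x + qnorm A y))"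

definition quasi_banach :: "'a::real_vector qspace \<Rightarrow> bool" where
  "quasi_banach A \<longleftrightarrow>
     quasi_normed A \<and>
     (\<forall>s::nat \<Rightarrow> 'a. (\<forall>n. s n \<in> carr A) \<longrightarrow>
        (\<forall>e>0. \<exists>M. \<forall>m\<ge>M. \<forall>n\<ge>M. qnorm A (s m - s n) < e) \<longrightarrow>
        (\<exists>a\<in>carr A. (\<lambda>n. qnorm A (s n - a)) \<longlonglongrightarrow> 0))"

text \<open>
  The balls \<open>{y. qnorm A (y - x) < r}\<close> of a quasi-norm are neighbourhoods of \<open>x\<close>,
  but need not themselves be open.
\<close>

definition qtop :: "'a::real_vector qspace \<Rightarrow> 'a topology" where
  "qtop A = topology (\<lambda>U. U \<subseteq> carr A \<and>
     (\<forall>x\<in>U. \<exists>r>0. {y \<in> carr A. qnorm A (y - x) < r} \<subseteq> U))"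

lemma openin_qtop:
  "openin (qtop A) U \<longleftrightarrow>
     U \<subseteq> carr A \<and> (\<forall>x\<in>U. \<exists>r>0. {y \<in> carr A. qnorm A (y - x) < r} \<subseteq> U)"
proof -
  have "istopology (\<lambda>U. U \<subseteq> carr A \<and>
     (\<forall>x\<in>U. \<exists>r>0. {y \<in> carr A. qnorm A (y - x) < r} \<subseteq> U))"
    unfolding istopology_def
  proof (rule conjI; intro allI impI conjI ballI; (elim conjE)?)
    fix S T x
    assume S: "\<forall>x\<in>S. \<exists>r>0. {y \<in> carr A. qnorm A (y - x) < r} \<subseteq> S"
      and T: "\<forall>x\<in>T. \<exists>r>0. {y \<in> carr A. qnorm A (y - x) < r} \<subseteq> T"
      and x: "x \<in> S \<inter> T"
    obtain r where "r > 0" "{y \<in> carr A. qnorm A (y - x) < r} \<subseteq> S" using S x by blast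
    moreover obtain r' where "r' > 0" "{y \<in> carr A. qnorm A (y - x) < r'} \<subseteq> T" using T x by blast
    ultimately show "\<exists>r>0. {y \<in> carr A. qnorm A (y - x) < r} \<subseteq> S \<inter> T"
      by (intro exI[of _ "min r r'"]) auto
  next
    fix \<K> x
    assume K: "\<forall>K\<in>\<K>. K \<subseteq> carr A \<and>
        (\<forall>x\<in>K. \<exists>r>0. {y \<in> carr A. qnorm A (y - x) < r} \<subseteq> K)"
      and "x \<in> \<Union> \<K>"
    then obtain K where "K \<in> \<K>" "x \<in> K" by blast
    with K obtain r where "r > 0" "{y \<in> carr A. qnorm A (y - x) < r} \<subseteq> K" by meson
    with \<open>K \<in> \<K>\<close> show "\<exists>r>0. {y \<in> carr A. qnorm A (y - x) < r} \<subseteq> \<Union> \<K>" by blast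
  qed blast+
  then show ?thesis
    by (simp add: qtop_def topology_inverse')
qed

lemma topspace_qtop: "topspace (qtop A) = carr A"
proof -
  have "openin (qtop A) (carr A)"
    unfolding openin_qtop by (auto intro: exI[of _ 1])
  then show ?thesis
    by (meson openin_qtop openin_subset openin_topspace subset_antisym)
qed

definition continuously_included :: "'a::real_vector qspace \<Rightarrow> 'a qspace \<Rightarrow> bool"
    (infix "\<hookrightarrow>" 50) where
  "A \<hookrightarrow> B \<longleftrightarrow> carr A \<subseteq> carr B \<and> continuous_map (qtop A) (qtop B) (\<lambda>x. x)"

definition quasi_banach_couple ::
    "'a::hausdorff_tvs qspace \<Rightarrow> 'a qspace \<Rightarrow> bool" where
  "quasi_banach_couple A0 A1 \<longleftrightarrow>
     quasi_banach A0 \<and> continuous_map (qtop A0) euclidean (\<lambda>x. x) \<and>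
     quasi_banach A1 \<and> continuous_map (qtop A1) euclidean (\<lambda>x. x)"

text \<open>Only meaningful for \<open>x\<close> in the sum of the two spaces.\<close>

definition K_fun :: "'a::real_vector qspace \<Rightarrow> 'a qspace \<Rightarrow> 'a \<Rightarrow> real \<Rightarrow> real" where
  "K_fun A0 A1 x t =
     Inf {qnorm A0 a0 + t * qnorm A1 a1 | a0 a1. a0 \<in> carr A0 \<and> a1 \<in> carr A1 \<and> x = a0 + a1}"

definition sum_space :: "'a::real_vector qspace \<Rightarrow> 'a qspace \<Rightarrow> 'a qspace" where
  "sum_space A0 A1 =
     \<lparr>carr = {a0 + a1 | a0 a1. a0 \<in> carr A0 \<and> a1 \<in> carr A1},
      qnorm = (\<lambda>x. K_fun A0 A1 x 1)\<rparr>"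

definition inter_space :: "'a::real_vector qspace \<Rightarrow> 'a qspace \<Rightarrow> 'a qspace" where
  "inter_space A0 A1 =
     \<lparr>carr = carr A0 \<inter> carr A1, qnorm = (\<lambda>x. max (qnorm A0 x) (qnorm A1 x))\<rparr>"

text \<open>For \<open>x\<close> in the sum, the value is \<open>\<infinity>\<close> iff \<open>x\<close> is not in the interpolation space.\<close>

definition interp_norm ::
    "'a::real_vector qspace \<Rightarrow> 'a qspace \<Rightarrow> real \<Rightarrow> ennreal \<Rightarrow> 'a \<Rightarrow> ennreal" where
  "interp_norm A0 A1 \<theta> q x =
     (if q = \<infinity> then (SUP t\<in>{0<..}. ennreal (t powr (-\<theta>) * K_fun A0 A1 x t))
      else let I = (\<integral>\<^sup>+t\<in>{0<..}. ennreal ((t powr (-\<theta>) * K_fun A0 A1 x t) powr enn2real q / t) \<partial>lborel)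
           in if I = \<infinity> then \<infinity> else ennreal (enn2real I powr (1 / enn2real q)))"

definition interp_space ::
    "'a::real_vector qspace \<Rightarrow> 'a qspace \<Rightarrow> real \<Rightarrow> ennreal \<Rightarrow> 'a qspace" where
  "interp_space A0 A1 \<theta> q =
     \<lparr>carr = {x \<in> carr (sum_space A0 A1). interp_norm A0 A1 \<theta> q x < \<infinity>},
      qnorm = (\<lambda>x. enn2real (interp_norm A0 A1 \<theta> q x))\<rparr>"

end

theory Submission
  imports Defs
begin

text \<open>
  A gliding-hump argument shows that an inclusion between spaces of the form
  \<open>{x. \<exists>B. \<forall>t>0. K x t \<le> B * w t}\<close> is automatically bounded. No completeness of the space
  \<open>(A0, A1)\<^bsub>\<theta>,q\<^esub>\<close> itself is needed: it lies between two spaces of this form, whatever \<open>q\<close> is.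

  If \<open>(A0, A1)\<^bsub>\<theta>,q\<^esub> = A0 + A1\<close>, boundedness gives \<open>K x t \<le> C * t powr \<theta> * K x 1\<close>. For small \<open>t\<close>
  every \<open>x\<close> is then approximated by an element of \<open>A1\<close> with a small relative error;
  iterating, \<open>x\<close> is the sum of a series in \<open>A1\<close>. For large \<open>t\<close> the same holds with \<open>A0\<close>.

  If \<open>(A0, A1)\<^bsub>\<theta>,q\<^esub> = A0 \<inter> A1\<close>, boundedness for
  \<open>w t = min 1 t powr (1 - \<eta>) * max 1 t powr \<eta>\<close> with \<open>\<eta>\<close> small gives, after interpolating between
  the trivial bounds on \<open>K\<close>, that \<open>K x t \<le> C * min 1 t * K x 1\<close> on \<open>A0 \<inter> A1\<close>. The same iteration
  inside \<open>A0 \<inter> A1\<close> then bounds the norms of \<open>A0\<close> and \<open>A1\<close> by that of \<open>A0 + A1\<close>, so the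
  intersection is closed.
\<close>

section \<open>Series in quasi-seminormed spaces\<close>

text \<open>The triangle constant is a parameter so that one \<open>\<kappa>\<close> can serve both
  norms and \<open>K\<close> at every \<open>t\<close>. Definiteness is a separate matter: for
  \<open>K\<close> it rests on the Hausdorff ambient space.\<close>

definition quasi_seminorm :: "real \<Rightarrow> 'a::real_vector set \<Rightarrow> ('a \<Rightarrow> real) \<Rightarrow> bool" where
  "quasi_seminorm \<kappa> V p \<longleftrightarrow>
     1 \<le> \<kappa> \<and> subspace V \<and> (\<forall>x\<in>V. 0 \<le> p x) \<and>
     (\<forall>c. \<forall>x\<in>V. p (c *\<^sub>R x) = \<bar>c\<bar> * p x) \<and>
     (\<forall>x\<in>V. \<forall>y\<in>V. p (x + y) \<le> \<kappa> * (p x + p y))"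

lemma quasi_seminormD:
  assumes "quasi_seminorm \<kappa> V p"
  shows quasi_seminorm_ge1: "1 \<le> \<kappa>"
    and quasi_seminorm_subspace: "subspace V"
    and quasi_seminorm_nonneg: "x \<in> V \<Longrightarrow> 0 \<le> p x"
    and quasi_seminorm_scale: "x \<in> V \<Longrightarrow> p (c *\<^sub>R x) = \<bar>c\<bar> * p x"
    and quasi_seminorm_triangle: "x \<in> V \<Longrightarrow> y \<in> V \<Longrightarrow> p (x + y) \<le> \<kappa> * (p x + p y)"
  using assms by (auto simp: quasi_seminorm_def)

lemma quasi_seminorm_zero: "quasi_seminorm \<kappa> V p \<Longrightarrow> p 0 = 0"
  using quasi_seminorm_scale[of \<kappa> V p 0 0] quasi_seminorm_subspace subspace_0 by fastforce

lemma quasi_seminorm_minus: "quasi_seminorm \<kappa> V p \<Longrightarrow> x \<in> V \<Longrightarrow> p (- x) = p x"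
  using quasi_seminorm_scale[of \<kappa> V p x "-1"] by simp

lemma quasi_seminorm_commute:
  "quasi_seminorm \<kappa> V p \<Longrightarrow> x \<in> V \<Longrightarrow> y \<in> V \<Longrightarrow> p (x - y) = p (y - x)"
  using quasi_seminorm_minus[of \<kappa> V p "x - y"] quasi_seminorm_subspace subspace_diff by fastforce

lemma quasi_seminorm_diff:
  assumes "quasi_seminorm \<kappa> V p" "x \<in> V" "y \<in> V" "z \<in> V"
  shows "p (x - z) \<le> \<kappa> * (p (x - y) + p (y - z))"
  using quasi_seminorm_triangle[OF assms(1), of "x - y" "y - z"] assms
  by (simp add: quasi_seminorm_subspace subspace_diff)

lemma quasi_seminorm_diff_le:
  assumes "quasi_seminorm \<kappa> V p" "x \<in> V" "y \<in> V"
  shows "p (x - y) \<le> \<kappa> * (p x + p y)"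
  using quasi_seminorm_diff[OF assms(1,2) _ assms(3), of 0] assms
  by (simp add: quasi_seminorm_subspace subspace_0 quasi_seminorm_minus)

lemma quasi_seminorm_mono_const:
  assumes "quasi_seminorm \<kappa> V p" "\<kappa> \<le> \<kappa>'"
  shows "quasi_seminorm \<kappa>' V p"
proof -
  have "p (x + y) \<le> \<kappa>' * (p x + p y)" if "x \<in> V" "y \<in> V" for x y
    using quasi_seminorm_triangle[OF assms(1) that]
      mult_right_mono[OF assms(2), of "p x + p y"] quasi_seminorm_nonneg[OF assms(1)] that
    by fastforce
  then show ?thesis
    using assms unfolding quasi_seminorm_def by auto
qed

text \<open>Splitting off the first term costs a factor \<open>\<kappa>\<close> at every step; the
  condition \<open>\<kappa> * \<delta> \<le> 1/2\<close> absorbs it, so the constant does not grow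
  with \<open>k\<close>.\<close>

lemma quasi_seminorm_geometric_sum:
  assumes p: "quasi_seminorm \<kappa> V p" and z: "\<And>m. z m \<in> V"
    and \<delta>: "0 \<le> \<delta>" "\<kappa> * \<delta> \<le> 1/2" and c: "0 \<le> c"
    and le: "\<And>m. m \<ge> n \<Longrightarrow> p (z m) \<le> c * \<delta> ^ m"
  shows "p (\<Sum>m=n..<n+k. z m) \<le> 2 * \<kappa> * c * \<delta> ^ n"
  using le
proof (induction k arbitrary: n)
  case 0
  then show ?case
    using quasi_seminorm_zero[OF p] quasi_seminorm_ge1[OF p] \<delta> c by simp
next
  case (Suc k)
  have V: "(\<Sum>m=Suc n..<Suc n+k. z m) \<in> V"
    using z by (intro subspace_sum quasi_seminorm_subspace[OF p])
  have IH: "p (\<Sum>m=Suc n..<Suc n+k. z m) \<le> 2 * \<kappa> * c * \<delta> ^ Suc n"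
    using Suc.prems by (intro Suc.IH) auto
  have \<kappa>: "0 \<le> \<kappa>"
    using quasi_seminorm_ge1[OF p] by simp
  have "(\<Sum>m=n..<n+Suc k. z m) = z n + (\<Sum>m=Suc n..<Suc n+k. z m)"
    by (subst sum.atLeast_Suc_lessThan) auto
  then have "p (\<Sum>m=n..<n+Suc k. z m) \<le> \<kappa> * (p (z n) + p (\<Sum>m=Suc n..<Suc n+k. z m))"
    using quasi_seminorm_triangle[OF p z V, of n] by simp
  also have "\<dots> \<le> \<kappa> * (c * \<delta> ^ n + 2 * \<kappa> * c * \<delta> ^ Suc n)"
    using IH Suc.prems[of n] \<kappa> by (intro mult_left_mono add_mono) auto
  also have "\<dots> = \<kappa> * (c * \<delta> ^ n) + 2 * (\<kappa> * (c * \<delta> ^ n)) * (\<kappa> * \<delta>)"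
    by (simp add: algebra_simps)
  also have "\<dots> \<le> \<kappa> * (c * \<delta> ^ n) + 2 * (\<kappa> * (c * \<delta> ^ n)) * (1/2)"
    using \<delta> \<kappa> c by (intro add_left_mono mult_left_mono) auto
  finally show ?case by simp
qed

lemma quasi_seminorm_partial_sums_diff:
  assumes p: "quasi_seminorm \<kappa> V p" and z: "\<And>m. z m \<in> V"
    and \<delta>: "0 \<le> \<delta>" "\<kappa> * \<delta> \<le> 1/2" and c: "0 \<le> c"
    and le: "\<And>m. m \<ge> n \<Longrightarrow> p (z m) \<le> c * \<delta> ^ m" and "n \<le> N"
  shows "p ((\<Sum>m<N. z m) - (\<Sum>m<n. z m)) \<le> 2 * \<kappa> * c * \<delta> ^ n"
proof -
  obtain k where k: "N = n + k"
    using \<open>n \<le> N\<close> le_Suc_ex by blast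
  have "(\<Sum>m<N. z m) - (\<Sum>m<n. z m) = (\<Sum>m=n..<n+k. z m)"
    unfolding k by (metis add_diff_cancel_left' atLeast0LessThan le_add1 sum.atLeastLessThan_concat zero_le)
  then show ?thesis
    using quasi_seminorm_geometric_sum[OF p z \<delta> c le] by simp
qed

text \<open>A quasi-seminorm may fail to be continuous, so the bound on finite blocks cannot simply
  be passed to the limit. The partial sum up to \<open>N\<close> is inserted instead, at the cost of
  one more \<open>\<kappa>\<close>.\<close>

lemma quasi_seminorm_series_tail:
  assumes p: "quasi_seminorm \<kappa> V p" and z: "\<And>m. z m \<in> V" and x: "x \<in> V"
    and \<delta>: "0 \<le> \<delta>" "\<kappa> * \<delta> \<le> 1/2" and c: "0 \<le> c"
    and le: "\<And>m. m \<ge> n \<Longrightarrow> p (z m) \<le> c * \<delta> ^ m"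
    and lim: "(\<lambda>N. p ((\<Sum>m<N. z m) - x)) \<longlonglongrightarrow> 0"
  shows "p (x - (\<Sum>m<n. z m)) \<le> 2 * \<kappa>\<^sup>2 * c * \<delta> ^ n"
proof (rule LIMSEQ_le_const)
  show "(\<lambda>N. \<kappa> * (p ((\<Sum>m<N. z m) - x) + 2 * \<kappa> * c * \<delta> ^ n)) \<longlonglongrightarrow> 2 * \<kappa>\<^sup>2 * c * \<delta> ^ n"
    by (rule tendsto_eq_intros lim refl)+ (simp add: power2_eq_square)
  have S: "(\<Sum>m<N. z m) \<in> V" for N
    using z by (intro subspace_sum quasi_seminorm_subspace[OF p])
  have "p (x - (\<Sum>m<n. z m)) \<le> \<kappa> * (p ((\<Sum>m<N. z m) - x) + 2 * \<kappa> * c * \<delta> ^ n)"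
    if "n \<le> N" for N
  proof -
    have "p (x - (\<Sum>m<n. z m))
        \<le> \<kappa> * (p (x - (\<Sum>m<N. z m)) + p ((\<Sum>m<N. z m) - (\<Sum>m<n. z m)))"
      by (intro quasi_seminorm_diff[OF p] x S)
    also have "\<dots> \<le> \<kappa> * (p ((\<Sum>m<N. z m) - x) + 2 * \<kappa> * c * \<delta> ^ n)"
      using quasi_seminorm_partial_sums_diff[OF p z \<delta> c le that] quasi_seminorm_ge1[OF p]
        quasi_seminorm_commute[OF p x S]
      by (intro mult_left_mono add_mono) auto
    finally show ?thesis .
  qed
  then show "\<exists>N. \<forall>n'\<ge>N. p (x - (\<Sum>m<n. z m)) \<le> \<kappa> * (p ((\<Sum>m<n'. z m) - x) + 2 * \<kappa> * c * \<delta> ^ n)"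
    by blast
qed

lemma quasi_banach_quasi_seminorm:
  "quasi_banach A \<Longrightarrow> \<exists>\<kappa>. quasi_seminorm \<kappa> (carr A) (qnorm A)"
  by (auto simp: quasi_banach_def quasi_normed_def quasi_seminorm_def)

lemma quasi_banach_Cauchy_limit:
  assumes A: "quasi_banach A" and s: "\<And>n. s n \<in> carr A" and f: "f \<longlonglongrightarrow> (0::real)"
    and le: "\<And>m n. m \<le> n \<Longrightarrow> qnorm A (s n - s m) \<le> f m"
  shows "\<exists>a\<in>carr A. (\<lambda>n. qnorm A (s n - a)) \<longlonglongrightarrow> 0"
proof -
  obtain \<kappa> where p: "quasi_seminorm \<kappa> (carr A) (qnorm A)"
    using quasi_banach_quasi_seminorm[OF A] ..
  have "\<exists>M. \<forall>m\<ge>M. \<forall>n\<ge>M. qnorm A (s m - s n) < e" if "e > 0" for e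
  proof -
    obtain M where M: "\<And>m. m \<ge> M \<Longrightarrow> f m < e"
      using order_tendstoD(2)[OF f \<open>e > 0\<close>] by (auto simp: eventually_sequentially)
    have "qnorm A (s m - s n) < e" if "m \<ge> M" "n \<ge> M" for m n
      using le[of m n] le[of n m] M[of m] M[of n] that quasi_seminorm_commute[OF p s s, of m n]
      by (cases "m \<le> n") (force simp: not_le)+
    then show ?thesis by blast
  qed
  then show ?thesis
    using A s unfolding quasi_banach_def by blast
qed

lemma quasi_banach_geometric_series:
  assumes A: "quasi_banach A" and p: "quasi_seminorm \<kappa> (carr A) (qnorm A)"
    and z: "\<And>m. z m \<in> carr A" and \<delta>: "0 \<le> \<delta>" "\<kappa> * \<delta> \<le> 1/2" and c: "0 \<le> c"
    and le: "\<And>m. qnorm A (z m) \<le> c * \<delta> ^ m"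
  shows "\<exists>a\<in>carr A. (\<lambda>n. qnorm A ((\<Sum>m<n. z m) - a)) \<longlonglongrightarrow> 0"
proof (rule quasi_banach_Cauchy_limit[OF A])
  show "(\<Sum>m<n. z m) \<in> carr A" for n
    using z by (intro subspace_sum quasi_seminorm_subspace[OF p])
  \<comment> \<open>Since \<open>1 \<le> \<kappa>\<close>, the condition on
    \<open>\<kappa> * \<delta>\<close> forces \<open>\<delta> \<le> 1/2\<close>, and the tail bounds
    tend to 0.\<close>
  have "1 * \<delta> \<le> \<kappa> * \<delta>"
    using quasi_seminorm_ge1[OF p] \<delta> by (intro mult_right_mono) auto
  then have "\<delta> < 1" using \<delta> by simp
  then show "(\<lambda>n. 2 * \<kappa> * c * \<delta> ^ n) \<longlonglongrightarrow> 0"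
    using \<delta> by (auto intro!: tendsto_eq_intros LIMSEQ_power_zero)
  show "qnorm A ((\<Sum>m<n. z m) - (\<Sum>i<m. z i)) \<le> 2 * \<kappa> * c * \<delta> ^ m" if "m \<le> n" for m n
    by (rule quasi_seminorm_partial_sums_diff[OF p z \<delta> c le that])
qed

section \<open>The K-functional\<close>

locale quasi_couple =
  fixes A0 A1 :: "'a::hausdorff_tvs qspace"
  assumes couple: "quasi_banach_couple A0 A1"
begin

abbreviation "S \<equiv> carr (sum_space A0 A1)"
abbreviation "K \<equiv> K_fun A0 A1"

lemma banach0: "quasi_banach A0" and banach1: "quasi_banach A1"
  using couple by (auto simp: quasi_banach_couple_def)

lemma subspace0: "subspace (carr A0)" and subspace1: "subspace (carr A1)"
  using banach0 banach1 by (auto simp: quasi_banach_def quasi_normed_def)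

lemma nonneg0: "a \<in> carr A0 \<Longrightarrow> 0 \<le> qnorm A0 a"
  and nonneg1: "a \<in> carr A1 \<Longrightarrow> 0 \<le> qnorm A1 a"
  and zero0: "qnorm A0 0 = 0" and zero1: "qnorm A1 0 = 0"
  and scale0: "a \<in> carr A0 \<Longrightarrow> qnorm A0 (c *\<^sub>R a) = \<bar>c\<bar> * qnorm A0 a"
  and scale1: "a \<in> carr A1 \<Longrightarrow> qnorm A1 (c *\<^sub>R a) = \<bar>c\<bar> * qnorm A1 a"
  using banach0 banach1 subspace_0[OF subspace0] subspace_0[OF subspace1]
  by (auto simp: quasi_banach_def quasi_normed_def)

lemma sum_carr: "x \<in> S \<longleftrightarrow> (\<exists>a0\<in>carr A0. \<exists>a1\<in>carr A1. x = a0 + a1)"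
  by (auto simp: sum_space_def)

lemma sum_qnorm: "qnorm (sum_space A0 A1) x = K x 1"
  by (simp add: sum_space_def)

lemma subspace_S: "subspace S"
proof -
  show ?thesis
    using subspace_sums[OF subspace0 subspace1] by (simp add: sum_space_def)
qed

lemma carr0_sub: "carr A0 \<subseteq> S" and carr1_sub: "carr A1 \<subseteq> S"
  unfolding sum_carr subset_iff using subspace_0[OF subspace0] subspace_0[OF subspace1]
  by (metis add_0_right, metis add_0_left)

lemma K_le:
  assumes "a0 \<in> carr A0" "a1 \<in> carr A1" "0 \<le> t"
  shows "K (a0 + a1) t \<le> qnorm A0 a0 + t * qnorm A1 a1"
  unfolding K_fun_def using assms nonneg0 nonneg1
  by (intro cInf_lower bdd_belowI[of _ 0]) auto

lemma K_ge:
  assumes "x \<in> S"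
    and "\<And>a0 a1. a0 \<in> carr A0 \<Longrightarrow> a1 \<in> carr A1 \<Longrightarrow> x = a0 + a1 \<Longrightarrow> c \<le> qnorm A0 a0 + t * qnorm A1 a1"
  shows "c \<le> K x t"
  unfolding K_fun_def using assms unfolding sum_carr by (intro cInf_greatest) auto

lemma K_decomp:
  assumes "x \<in> S" "K x t < c"
  obtains a0 a1 where "a0 \<in> carr A0" "a1 \<in> carr A1" "x = a0 + a1"
    "qnorm A0 a0 + t * qnorm A1 a1 < c"
  using K_ge[OF assms(1), of c t] assms(2) by (meson not_le)

lemma K_nonneg: "x \<in> S \<Longrightarrow> 0 \<le> t \<Longrightarrow> 0 \<le> K x t"
  by (rule K_ge) (auto simp: nonneg0 nonneg1)

lemma K_le_carr0: "x \<in> carr A0 \<Longrightarrow> 0 \<le> t \<Longrightarrow> K x t \<le> qnorm A0 x"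
  using K_le[of x 0 t] subspace_0[OF subspace1] by (simp add: zero1)

lemma K_le_carr1: "x \<in> carr A1 \<Longrightarrow> 0 \<le> t \<Longrightarrow> K x t \<le> t * qnorm A1 x"
  using K_le[of 0 x t] subspace_0[OF subspace0] by (simp add: zero0)

lemma K_mono: "x \<in> S \<Longrightarrow> 0 \<le> s \<Longrightarrow> s \<le> t \<Longrightarrow> K x s \<le> K x t"
proof (rule K_ge)
  fix a0 a1 assume *: "a0 \<in> carr A0" "a1 \<in> carr A1" "x = a0 + a1" "0 \<le> s" "s \<le> t"
  then show "K x s \<le> qnorm A0 a0 + t * qnorm A1 a1"
    using K_le[of a0 a1 s] mult_right_mono[OF \<open>s \<le> t\<close> nonneg1[of a1]] by simp
qed

lemma K_le_max:
  assumes "x \<in> S" "0 < t"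
  shows "K x t \<le> max 1 t * K x 1"
proof -
  \<comment> \<open>The factor goes to the left because \<open>K_ge\<close> bounds an infimum below
    by a constant, decomposition by decomposition.\<close>
  have "K x t / max 1 t \<le> K x 1"
  proof (rule K_ge[OF assms(1)])
    fix a0 a1 assume *: "a0 \<in> carr A0" "a1 \<in> carr A1" "x = a0 + a1"
    have "K x t \<le> qnorm A0 a0 + t * qnorm A1 a1"
      using K_le[of a0 a1 t] * assms by simp
    also have "\<dots> \<le> max 1 t * qnorm A0 a0 + max 1 t * qnorm A1 a1"
      using nonneg0 nonneg1 * mult_right_mono[of 1 "max 1 t" "qnorm A0 a0"]
      by (intro add_mono mult_right_mono) auto
    finally show "K x t / max 1 t \<le> qnorm A0 a0 + 1 * qnorm A1 a1"
      by (simp add: pos_divide_le_eq algebra_simps)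
  qed
  then show ?thesis
    by (simp add: pos_divide_le_eq mult.commute)
qed

lemma K_scale:
  assumes "x \<in> S" "0 \<le> t"
  shows "K (c *\<^sub>R x) t = \<bar>c\<bar> * K x t"
proof -
  have le: "K (c *\<^sub>R x) t \<le> \<bar>c\<bar> * K x t" if "x \<in> S" "c \<noteq> 0" for x c
  proof -
    have "K (c *\<^sub>R x) t / \<bar>c\<bar> \<le> K x t"
    proof (rule K_ge[OF \<open>x \<in> S\<close>])
      fix a0 a1 assume *: "a0 \<in> carr A0" "a1 \<in> carr A1" "x = a0 + a1"
      have "K (c *\<^sub>R a0 + c *\<^sub>R a1) t \<le> qnorm A0 (c *\<^sub>R a0) + t * qnorm A1 (c *\<^sub>R a1)"
        using * assms by (intro K_le subspace_scale subspace0 subspace1)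
      then show "K (c *\<^sub>R x) t / \<bar>c\<bar> \<le> qnorm A0 a0 + t * qnorm A1 a1"
        using * \<open>c \<noteq> 0\<close> by (simp add: scaleR_add_right scale0 scale1 field_simps)
    qed
    then show ?thesis
      using \<open>c \<noteq> 0\<close> by (simp add: field_simps)
  qed
  show ?thesis
  proof (cases "c = 0")
    case True
    have "K (0 + 0) t \<le> 0"
      using K_le[of 0 0 t] subspace_0[OF subspace0] subspace_0[OF subspace1] assms
      by (simp add: zero0 zero1)
    then show ?thesis
      using True K_nonneg[OF subspace_0[OF subspace_S] \<open>0 \<le> t\<close>] by simp
  next
    case False
    \<comment> \<open>The reverse inequality is the first one applied to
      \<open>c *\<^sub>R x\<close> with the factor \<open>inverse c\<close>.\<close>
    have "K x t \<le> K (c *\<^sub>R x) t / \<bar>c\<bar>"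
      using le[of "c *\<^sub>R x" "inverse c"] False subspace_scale[OF subspace_S \<open>x \<in> S\<close>, of c]
      by (simp add: field_simps)
    then show ?thesis
      using le[OF \<open>x \<in> S\<close> False] False by (simp add: field_simps)
  qed
qed

text \<open>The two infima are taken one at a time: with a decomposition of \<open>y\<close> fixed,
  the estimate becomes a lower bound for \<open>K x t\<close>; rearranged, it becomes one for
  \<open>K y t\<close>.\<close>

lemma K_add:
  assumes p0: "quasi_seminorm \<kappa> (carr A0) (qnorm A0)" and p1: "quasi_seminorm \<kappa> (carr A1) (qnorm A1)"
    and x: "x \<in> S" and y: "y \<in> S" and t: "0 \<le> t"
  shows "K (x + y) t \<le> \<kappa> * (K x t + K y t)"
proof -
  have \<kappa>: "0 < \<kappa>" using quasi_seminorm_ge1[OF p0] by simp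
  have *: "K (x + y) t / \<kappa> - (qnorm A0 b0 + t * qnorm A1 b1) \<le> K x t"
    if b: "b0 \<in> carr A0" "b1 \<in> carr A1" "y = b0 + b1" for b0 b1
  proof (rule K_ge[OF x])
    fix a0 a1 assume a: "a0 \<in> carr A0" "a1 \<in> carr A1" "x = a0 + a1"
    have "K ((a0 + b0) + (a1 + b1)) t \<le> qnorm A0 (a0 + b0) + t * qnorm A1 (a1 + b1)"
      using a b t by (intro K_le subspace_add subspace0 subspace1)
    also have "\<dots> \<le> \<kappa> * (qnorm A0 a0 + qnorm A0 b0) + t * (\<kappa> * (qnorm A1 a1 + qnorm A1 b1))"
      using a b t by (intro add_mono mult_left_mono quasi_seminorm_triangle[OF p0] quasi_seminorm_triangle[OF p1])
    finally show "K (x + y) t / \<kappa> - (qnorm A0 b0 + t * qnorm A1 b1) \<le> qnorm A0 a0 + t * qnorm A1 a1"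
      using \<kappa> a b by (simp add: field_simps)
  qed
  have "K (x + y) t / \<kappa> - K x t \<le> K y t"
    using * by (intro K_ge[OF y]) (force simp: algebra_simps)
  then show ?thesis
    using \<kappa> by (simp add: field_simps)
qed

text \<open>The maximum of the two triangle constants works for all \<open>t\<close> simultaneously.
  This uniformity is what allows the gliding hump below to change \<open>t\<close> at every
  step.\<close>

lemma K_quasi_seminorm:
  obtains \<kappa> where "quasi_seminorm \<kappa> (carr A0) (qnorm A0)" "quasi_seminorm \<kappa> (carr A1) (qnorm A1)"
    "\<And>t. 0 \<le> t \<Longrightarrow> quasi_seminorm \<kappa> S (\<lambda>x. K x t)"
proof -
  obtain \<kappa>0 where "quasi_seminorm \<kappa>0 (carr A0) (qnorm A0)"
    using quasi_banach_quasi_seminorm[OF banach0] ..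
  then have p0: "quasi_seminorm (max \<kappa>0 \<kappa>1) (carr A0) (qnorm A0)" for \<kappa>1
    by (rule quasi_seminorm_mono_const) simp
  obtain \<kappa>1 where "quasi_seminorm \<kappa>1 (carr A1) (qnorm A1)"
    using quasi_banach_quasi_seminorm[OF banach1] ..
  then have p1: "quasi_seminorm (max \<kappa>0 \<kappa>1) (carr A1) (qnorm A1)"
    by (rule quasi_seminorm_mono_const) simp
  have "quasi_seminorm (max \<kappa>0 \<kappa>1) S (\<lambda>x. K x t)" if "0 \<le> t" for t
    using K_add[OF p0 p1 _ _ that] K_scale[OF _ that] K_nonneg[OF _ that] subspace_S
      quasi_seminorm_ge1[OF p1]
    by (simp add: quasi_seminorm_def)
  with p0 p1 show thesis by (rule that)
qed

end

section \<open>Limits and geometric series in the sum space\<close>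

lemma continuous_inclusion_tendsto_0:
  fixes A :: "'a::hausdorff_tvs qspace"
  assumes "quasi_banach A" and cont: "continuous_map (qtop A) euclidean (\<lambda>x. x)"
    and s: "\<And>n. s n \<in> carr A" and lim: "(\<lambda>n. qnorm A (s n)) \<longlonglongrightarrow> 0"
  shows "s \<longlonglongrightarrow> 0"
proof (rule topological_tendstoI)
  fix U :: "'a set" assume "open U" "0 \<in> U"
  \<comment> \<open>Balls of a quasi-norm need not be open; the preimage of \<open>U\<close> is open
    in \<open>qtop A\<close> and therefore contains a ball around 0.\<close>
  have "openin (qtop A) {x \<in> topspace (qtop A). x \<in> U}"
    using cont \<open>open U\<close> by (auto simp: continuous_map_def)
  moreover have "0 \<in> {x \<in> topspace (qtop A). x \<in> U}"
    using assms(1) \<open>0 \<in> U\<close>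
    by (auto simp: topspace_qtop quasi_banach_def quasi_normed_def subspace_0)
  ultimately obtain r where "r > 0" and r: "{y \<in> carr A. qnorm A (y - 0) < r} \<subseteq> {x \<in> topspace (qtop A). x \<in> U}"
    unfolding openin_qtop by blast
  have "\<forall>\<^sub>F n in sequentially. qnorm A (s n) < r"
    using order_tendstoD(2)[OF lim \<open>r > 0\<close>] .
  then show "\<forall>\<^sub>F n in sequentially. s n \<in> U"
    by eventually_elim (use r s in auto)
qed

context quasi_couple
begin

text \<open>Compatibility of the couple enters here: \<open>x = a n + b n\<close> with both norms
  tending to 0, so both sequences tend to 0 in the common Hausdorff space, and so does the constant
  sequence \<open>x\<close>.\<close>

lemma K_eq_0_imp:
  assumes "x \<in> S" "K x 1 = 0"
  shows "x = 0"
proof -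
  have "\<exists>a0\<in>carr A0. \<exists>a1\<in>carr A1. x = a0 + a1 \<and> qnorm A0 a0 + 1 * qnorm A1 a1 < 1 / real (Suc n)" for n
  proof -
    have "K x 1 < 1 / real (Suc n)" using assms by simp
    then show ?thesis using K_decomp[OF assms(1)] by metis
  qed
  then obtain a b where a: "\<And>n. a n \<in> carr A0" and b: "\<And>n. b n \<in> carr A1" and x: "\<And>n. x = a n + b n"
    and le: "\<And>n. qnorm A0 (a n) + 1 * qnorm A1 (b n) < 1 / real (Suc n)"
    by metis
  have lim: "(\<lambda>n. 1 / real (Suc n)) \<longlonglongrightarrow> 0"
    using LIMSEQ_inverse_real_of_nat by (simp add: inverse_eq_divide)
  have "a \<longlonglongrightarrow> 0"
  proof (rule continuous_inclusion_tendsto_0[OF banach0 _ a])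
    show "(\<lambda>n. qnorm A0 (a n)) \<longlonglongrightarrow> 0"
    proof (rule tendsto_sandwich[OF _ _ tendsto_const lim])
      show "\<forall>\<^sub>F n in sequentially. 0 \<le> qnorm A0 (a n)"
        using nonneg0 a by auto
      have "qnorm A0 (a n) \<le> 1 / real (Suc n)" for n
        using le[of n] nonneg1[OF b, of n] by simp
      then show "\<forall>\<^sub>F n in sequentially. qnorm A0 (a n) \<le> 1 / real (Suc n)"
        by simp
    qed
  qed (use couple in \<open>auto simp: quasi_banach_couple_def\<close>)
  moreover have "b \<longlonglongrightarrow> 0"
  proof (rule continuous_inclusion_tendsto_0[OF banach1 _ b])
    show "(\<lambda>n. qnorm A1 (b n)) \<longlonglongrightarrow> 0"
    proof (rule tendsto_sandwich[OF _ _ tendsto_const lim])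
      show "\<forall>\<^sub>F n in sequentially. 0 \<le> qnorm A1 (b n)"
        using nonneg1 b by auto
      have "qnorm A1 (b n) \<le> 1 / real (Suc n)" for n
        using le[of n] nonneg0[OF a, of n] by simp
      then show "\<forall>\<^sub>F n in sequentially. qnorm A1 (b n) \<le> 1 / real (Suc n)"
        by simp
    qed
  qed (use couple in \<open>auto simp: quasi_banach_couple_def\<close>)
  ultimately have "(\<lambda>n. a n + b n) \<longlonglongrightarrow> 0 + 0"
    by (rule tendsto_add)
  then show "x = 0"
    using x LIMSEQ_unique[OF tendsto_const[of x]] by simp
qed

text \<open>Serves to identify a limit found in \<open>A0\<close> with an element already known in
  the sum.\<close>

lemma K_limit_unique:
  assumes S: "\<And>n. s n \<in> S" "x \<in> S" "y \<in> S"
    and x: "(\<lambda>n. K (s n - x) 1) \<longlonglongrightarrow> 0" and y: "(\<lambda>n. K (s n - y) 1) \<longlonglongrightarrow> 0"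
  shows "x = y"
proof -
  obtain \<kappa> where p: "quasi_seminorm \<kappa> S (\<lambda>x. K x 1)"
    using K_quasi_seminorm by (metis zero_le_one)
  have "K (x - y) 1 \<le> 0"
  proof (rule LIMSEQ_le_const)
    show "(\<lambda>n. \<kappa> * (K (s n - x) 1 + K (s n - y) 1)) \<longlonglongrightarrow> 0"
      by (rule tendsto_eq_intros x y refl)+ simp
    show "\<exists>N. \<forall>n\<ge>N. K (x - y) 1 \<le> \<kappa> * (K (s n - x) 1 + K (s n - y) 1)"
      using quasi_seminorm_diff[OF p S(2) S(1) S(3)] quasi_seminorm_commute[OF p S(1) S(2)] by auto
  qed
  moreover have "x - y \<in> S" using S subspace_diff[OF subspace_S] by blast
  ultimately have "x - y = 0"
    using K_nonneg[of "x - y" 1] by (intro K_eq_0_imp) auto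
  then show ?thesis by simp
qed

lemma K_tendsto_0:
  assumes s: "\<And>n. s n \<in> S" and lim: "(\<lambda>n. K (s n) 1) \<longlonglongrightarrow> 0" and "0 < t"
  shows "(\<lambda>n. K (s n) t) \<longlonglongrightarrow> 0"
proof (rule tendsto_sandwich[OF _ _ tendsto_const])
  show "(\<lambda>n. max 1 t * K (s n) 1) \<longlonglongrightarrow> 0"
    using tendsto_mult_right_zero[OF lim] .
  show "\<forall>\<^sub>F n in sequentially. 0 \<le> K (s n) t"
    using K_nonneg[OF s] \<open>0 < t\<close> by simp
  show "\<forall>\<^sub>F n in sequentially. K (s n) t \<le> max 1 t * K (s n) 1"
    using K_le_max[OF s \<open>0 < t\<close>] by simp
qed

text \<open>Each term is split almost optimally; the pieces form geometric series in
  \<open>A0\<close> and in \<open>A1\<close>, which converge by completeness of these two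
  spaces.\<close>

lemma sum_geometric_series:
  assumes p0: "quasi_seminorm \<kappa> (carr A0) (qnorm A0)" and p1: "quasi_seminorm \<kappa> (carr A1) (qnorm A1)"
    and z: "\<And>m. z m \<in> S" and \<delta>: "0 < \<delta>" "\<kappa> * \<delta> \<le> 1/2" and c: "0 \<le> c"
    and le: "\<And>m. K (z m) 1 \<le> c * \<delta> ^ m"
  shows "\<exists>x\<in>S. (\<lambda>n. K ((\<Sum>m<n. z m) - x) 1) \<longlonglongrightarrow> 0"
proof -
  have "\<exists>a0\<in>carr A0. \<exists>a1\<in>carr A1. z m = a0 + a1 \<and> qnorm A0 a0 + 1 * qnorm A1 a1 < (c + 1) * \<delta> ^ m" for m
  proof -
    \<comment> \<open>\<open>K_decomp\<close> needs a strict inequality; \<open>c + 1\<close>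
      provides it even for \<open>c = 0\<close>.\<close>
    have "K (z m) 1 < (c + 1) * \<delta> ^ m"
      using le[of m] zero_less_power[OF \<delta>(1), of m] by (simp add: algebra_simps)
    then show ?thesis using K_decomp[OF z] by metis
  qed
  then obtain a b where a: "\<And>n. a n \<in> carr A0" and b: "\<And>n. b n \<in> carr A1" and zab: "\<And>n. z n = a n + b n"
    and ab: "\<And>n. qnorm A0 (a n) + 1 * qnorm A1 (b n) < (c + 1) * \<delta> ^ n"
    by metis
  have la: "qnorm A0 (a n) \<le> (c + 1) * \<delta> ^ n" for n
    using ab[of n] nonneg1[OF b, of n] by simp
  have lb: "qnorm A1 (b n) \<le> (c + 1) * \<delta> ^ n" for n
    using ab[of n] nonneg0[OF a, of n] by simp
  obtain x0 where x0: "x0 \<in> carr A0" "(\<lambda>n. qnorm A0 ((\<Sum>m<n. a m) - x0)) \<longlonglongrightarrow> 0"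
    using quasi_banach_geometric_series[OF banach0 p0 a _ \<delta>(2) _ la] \<delta> c by auto
  obtain x1 where x1: "x1 \<in> carr A1" "(\<lambda>n. qnorm A1 ((\<Sum>m<n. b m) - x1)) \<longlonglongrightarrow> 0"
    using quasi_banach_geometric_series[OF banach1 p1 b _ \<delta>(2) _ lb] \<delta> c by auto
  have x: "x0 + x1 \<in> S"
    using x0 x1 sum_carr by blast
  have sa: "(\<Sum>m<n. a m) - x0 \<in> carr A0" and sb: "(\<Sum>m<n. b m) - x1 \<in> carr A1" for n
    using a b x0 x1 by (auto intro!: subspace_diff subspace_sum subspace0 subspace1)
  have eq: "(\<Sum>m<n. z m) - (x0 + x1) = ((\<Sum>m<n. a m) - x0) + ((\<Sum>m<n. b m) - x1)" for n
    by (simp add: zab sum.distrib)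
  have "(\<lambda>n. K ((\<Sum>m<n. z m) - (x0 + x1)) 1) \<longlonglongrightarrow> 0"
  proof (rule tendsto_sandwich[OF _ _ tendsto_const])
    show "(\<lambda>n. qnorm A0 ((\<Sum>m<n. a m) - x0) + 1 * qnorm A1 ((\<Sum>m<n. b m) - x1)) \<longlonglongrightarrow> 0"
      by (rule tendsto_eq_intros x0 x1 refl)+ simp
    show "\<forall>\<^sub>F n in sequentially. 0 \<le> K ((\<Sum>m<n. z m) - (x0 + x1)) 1"
      using z x by (intro always_eventually allI K_nonneg subspace_diff subspace_sum subspace_S) auto
    show "\<forall>\<^sub>F n in sequentially. K ((\<Sum>m<n. z m) - (x0 + x1)) 1
        \<le> qnorm A0 ((\<Sum>m<n. a m) - x0) + 1 * qnorm A1 ((\<Sum>m<n. b m) - x1)"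
      unfolding eq by (intro always_eventually allI K_le sa sb) simp
  qed
  with x show ?thesis by blast
qed

section \<open>Uniform boundedness\<close>

text \<open>The sign trick of Sokal's proof of the uniform boundedness theorem: one of
  \<open>s \<plusminus> y\<close> is at least as large as \<open>y\<close>, whatever \<open>s\<close> is.\<close>

lemma quasi_seminorm_sign:
  assumes p: "quasi_seminorm \<kappa> V p" and "s \<in> V" "y \<in> V"
  shows "\<exists>\<sigma>\<in>{1, -1::real}. p y / \<kappa> \<le> p (s + \<sigma> *\<^sub>R y)"
proof (rule ccontr)
  assume "\<not> ?thesis"
  then have lt: "p (s + y) < p y / \<kappa>" "p (s - y) < p y / \<kappa>"
    by auto
  have \<kappa>: "0 < \<kappa>" using quasi_seminorm_ge1[OF p] by simp
  have V: "s + y \<in> V" "s - y \<in> V"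
    using assms quasi_seminorm_subspace[OF p] by (auto intro: subspace_add subspace_diff)
  have "2 * p y = p (2 *\<^sub>R y)"
    using quasi_seminorm_scale[OF p \<open>y \<in> V\<close>, of 2] by simp
  also have "2 *\<^sub>R y = (s + y) - (s - y)"
    by (simp add: scaleR_2)
  also have "p \<dots> \<le> \<kappa> * (p (s + y) + p (s - y))"
    by (rule quasi_seminorm_diff_le[OF p V])
  also have "\<dots> < \<kappa> * (p y / \<kappa> + p y / \<kappa>)"
    using lt \<kappa> by (intro mult_strict_left_mono add_strict_mono) auto
  also have "\<dots> = 2 * p y"
    using \<kappa> by simp
  finally show False by simp
qed

text \<open>Let \<open>M t\<close> be the supremum of \<open>K x t\<close> over the unit ball
  \<open>U\<close> of the class of \<open>w\<close>. If \<open>M\<close> is not O(\<open>v\<close>),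
  a signed series of terms \<open>\<delta> ^ n *\<^sub>R y n\<close> with \<open>y n\<close> in
  \<open>U\<close> lies in the class of \<open>w\<close>, while at \<open>\<tau> n\<close> its
  \<open>K\<close> exceeds a fixed multiple of \<open>real n * v (\<tau> n)\<close>. This
  contradicts \<open>incl\<close>.\<close>

lemma K_uniform_bound:
  fixes v w :: "real \<Rightarrow> real"
  assumes w: "\<And>t. 0 < t \<Longrightarrow> 0 < w t" and v: "\<And>t. 0 < t \<Longrightarrow> 0 < v t"
    and incl: "\<And>x B. x \<in> S \<Longrightarrow> (\<And>t. 0 < t \<Longrightarrow> K x t \<le> B * w t) \<Longrightarrow> \<exists>B'. \<forall>t>0. K x t \<le> B' * v t"
  obtains C where "0 < C"
    "\<And>x B t. x \<in> S \<Longrightarrow> (\<And>t. 0 < t \<Longrightarrow> K x t \<le> B * w t) \<Longrightarrow> 0 < t \<Longrightarrow> K x t \<le> C * B * v t"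
proof -
  obtain \<kappa> where p0: "quasi_seminorm \<kappa> (carr A0) (qnorm A0)" and p1: "quasi_seminorm \<kappa> (carr A1) (qnorm A1)"
    and p: "\<And>t. 0 \<le> t \<Longrightarrow> quasi_seminorm \<kappa> S (\<lambda>x. K x t)"
    using K_quasi_seminorm by blast
  have \<kappa>: "1 \<le> \<kappa>" by (rule quasi_seminorm_ge1[OF p0])
  define U where "U = {x \<in> S. \<forall>t>0. K x t \<le> w t}"
  define M where "M t = Sup ((\<lambda>x. K x t) ` U)" for t
  have zero: "K 0 t = 0" if "0 \<le> t" for t
    using quasi_seminorm_zero[OF p[OF that]] .
  have "0 \<in> U"
    using w zero subspace_0[OF subspace_S] by (auto simp: U_def intro: less_imp_le)
  have M_upper: "K x t \<le> M t" if "x \<in> U" "0 < t" for x t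
    unfolding M_def using that by (intro cSup_upper bdd_aboveI[of _ "w t"]) (auto simp: U_def)
  have "\<exists>C. \<forall>t>0. M t \<le> C * v t"
  proof (rule ccontr)
    assume neg: "\<not> ?thesis"
    \<comment> \<open>Chosen for the final estimate: the tail after the \<open>n\<close>-th term,
      multiplied by \<open>\<kappa>\<close>, is then
      \<open>\<delta> ^ n * M (\<tau> n) / (4 * \<kappa>)\<close>, exactly half of the lower bound
      for the hump.\<close>
    define \<delta> where "\<delta> = 1 / (8 * \<kappa> ^ 4)"
    have \<delta>0: "0 < \<delta>" using \<kappa> by (simp add: \<delta>_def)
    have "\<kappa> * 1 \<le> \<kappa> * \<kappa> ^ 3"
      using \<kappa> by (intro mult_left_mono one_le_power) auto
    then have "\<kappa> \<le> \<kappa> ^ 4"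
      by (simp add: eval_nat_numeral mult.assoc)
    then have \<kappa>\<delta>: "\<kappa> * \<delta> \<le> 1/2"
      using \<kappa> by (simp add: \<delta>_def field_simps)
    have "\<exists>t>0. \<exists>y\<in>U. M t / 2 \<le> K y t \<and> real n / \<delta> ^ n * v t < M t" for n
    proof -
      obtain t where t: "t > 0" "real n / \<delta> ^ n * v t < M t"
        using neg not_le by blast
      have "0 \<le> real n / \<delta> ^ n * v t"
        using t v[of t] \<delta>0 by (intro mult_nonneg_nonneg) auto
      \<comment> \<open>\<open>M t\<close> exceeds a nonnegative number, so it is positive and its
        half lies strictly below the supremum.\<close>
      then have "M t / 2 < Sup ((\<lambda>x. K x t) ` U)"
        using t by (simp add: M_def)
      then obtain y where "y \<in> U" "M t / 2 < K y t"
        using less_cSupD[of "(\<lambda>x. K x t) ` U"] \<open>0 \<in> U\<close> by blast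
      with t show ?thesis by (intro exI[of _ t] conjI bexI[of _ y]) auto
    qed
    then obtain \<tau> y where \<tau>: "\<And>n. 0 < \<tau> n" and y: "\<And>n. y n \<in> U"
      and half: "\<And>n. M (\<tau> n) / 2 \<le> K (y n) (\<tau> n)"
      and big: "\<And>n. real n / \<delta> ^ n * v (\<tau> n) < M (\<tau> n)"
      by metis
    have yS: "y n \<in> S" for n
      using y by (auto simp: U_def)
    \<comment> \<open>The \<open>s n\<close> are the partial sums. The sign of the
      \<open>n\<close>-th term is chosen after all earlier ones, so that \<open>K\<close> at
      \<open>\<tau> n\<close> still sees that term, whatever has been summed before.\<close>
    have "\<exists>s. \<forall>n. (s n \<in> S \<and> (n = 0 \<longrightarrow> s n = 0)) \<and>
        (\<exists>\<sigma>\<in>{1, -1}. s (Suc n) = s n + \<sigma> *\<^sub>R \<delta> ^ n *\<^sub>R y n \<and>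
          \<delta> ^ n * K (y n) (\<tau> n) / \<kappa> \<le> K (s (Suc n)) (\<tau> n))"
    proof (rule dependent_nat_choice)
      show "\<exists>s. s \<in> S \<and> (0 = (0::nat) \<longrightarrow> s = 0)"
        using subspace_0[OF subspace_S] by auto
      fix s and n :: nat assume "s \<in> S \<and> (n = 0 \<longrightarrow> s = 0)"
      then have "s \<in> S" ..
      have yn: "\<delta> ^ n *\<^sub>R y n \<in> S"
        using yS by (intro subspace_scale subspace_S)
      obtain \<sigma> where \<sigma>: "\<sigma> \<in> {1, -1}"
        "K (\<delta> ^ n *\<^sub>R y n) (\<tau> n) / \<kappa> \<le> K (s + \<sigma> *\<^sub>R \<delta> ^ n *\<^sub>R y n) (\<tau> n)"
        using quasi_seminorm_sign[OF p \<open>s \<in> S\<close> yn, of "\<tau> n"] \<tau>[of n] by (meson less_imp_le)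
      moreover have "K (\<delta> ^ n *\<^sub>R y n) (\<tau> n) = \<delta> ^ n * K (y n) (\<tau> n)"
        using K_scale[OF yS, of "\<tau> n" "\<delta> ^ n" n] \<tau>[of n] \<delta>0 by simp
      moreover have "s + \<sigma> *\<^sub>R \<delta> ^ n *\<^sub>R y n \<in> S"
        using \<open>s \<in> S\<close> yn by (intro subspace_add subspace_scale[of S _ \<sigma>] subspace_S)
      ultimately show "\<exists>s'. (s' \<in> S \<and> (Suc n = 0 \<longrightarrow> s' = 0)) \<and>
        (\<exists>\<sigma>\<in>{1, -1}. s' = s + \<sigma> *\<^sub>R \<delta> ^ n *\<^sub>R y n \<and> \<delta> ^ n * K (y n) (\<tau> n) / \<kappa> \<le> K s' (\<tau> n))"
        by (intro exI[of _ "s + \<sigma> *\<^sub>R \<delta> ^ n *\<^sub>R y n"]) auto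
    qed
    then obtain s where s: "\<And>n. s n \<in> S" and s0: "s 0 = 0"
      and step: "\<And>n. \<exists>\<sigma>\<in>{1, -1}. s (Suc n) = s n + \<sigma> *\<^sub>R \<delta> ^ n *\<^sub>R y n"
      and low: "\<And>n. \<delta> ^ n * K (y n) (\<tau> n) / \<kappa> \<le> K (s (Suc n)) (\<tau> n)"
      by blast
    define z where "z n = s (Suc n) - s n" for n
    have z: "z n \<in> S" for n
      using s by (auto simp: z_def intro: subspace_diff subspace_S)
    have sum_z: "(\<Sum>m<n. z m) = s n" for n
      by (simp add: z_def sum_lessThan_telescope s0)
    have Kz: "K (z n) t = \<delta> ^ n * K (y n) t" if "0 < t" for n t
    proof -
      obtain \<sigma> where \<sigma>: "\<sigma> \<in> {1, -1}" "s (Suc n) = s n + \<sigma> *\<^sub>R \<delta> ^ n *\<^sub>R y n"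
        using step by blast
      then have "z n = (\<sigma> * \<delta> ^ n) *\<^sub>R y n"
        by (simp add: z_def)
      then show ?thesis
        using K_scale[OF yS, of t "\<sigma> * \<delta> ^ n" n] that \<sigma> \<delta>0 by (auto simp: abs_mult)
    qed
    \<comment> \<open>Two bounds on the same terms: the one by \<open>w\<close> gives convergence
      and puts the limit in the class of \<open>w\<close>; the one by \<open>M\<close> controls the
      tail at \<open>\<tau> n\<close>.\<close>
    have Kz_w: "K (z n) t \<le> w t * \<delta> ^ n" if "0 < t" for n t
      using Kz[OF that] y[of n] \<delta>0 that by (auto simp: U_def mult.commute)
    have Kz_M: "K (z n) t \<le> M t * \<delta> ^ n" if "0 < t" for n t
      using Kz[OF that] M_upper[OF y that] \<delta>0 that by (simp add: mult.commute)
    have w1: "0 \<le> w 1" using w[of 1] by simp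
    have "K (z m) 1 \<le> w 1 * \<delta> ^ m" for m
      by (rule Kz_w) simp
    then obtain x where x: "x \<in> S" and lim1: "(\<lambda>n. K ((\<Sum>m<n. z m) - x) 1) \<longlonglongrightarrow> 0"
      using sum_geometric_series[where z = z, OF p0 p1 z \<delta>0 \<kappa>\<delta> w1] by blast
    have lim: "(\<lambda>n. K ((\<Sum>m<n. z m) - x) t) \<longlonglongrightarrow> 0" if "0 < t" for t
    proof (rule K_tendsto_0[OF _ lim1 that])
      show "(\<Sum>m<n. z m) - x \<in> S" for n
        unfolding sum_z using s x by (intro subspace_diff subspace_S)
    qed
    have tail: "K (x - s n) t \<le> 2 * \<kappa>\<^sup>2 * c * \<delta> ^ n"
      if "0 < t" "0 \<le> c" "\<And>m. K (z m) t \<le> c * \<delta> ^ m" for n t c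
      using quasi_seminorm_series_tail[where z = z, OF p z x _ \<kappa>\<delta> \<open>0 \<le> c\<close> that(3) lim] that(1) \<delta>0
      by (simp add: sum_z)
    \<comment> \<open>The tail estimate at \<open>n = 0\<close>, where the partial sum is empty,
      bounds the whole series, so that \<open>incl\<close> applies to \<open>x\<close>.\<close>
    have "K x t \<le> 2 * \<kappa>\<^sup>2 * w t" if "0 < t" for t
      using tail[OF that _ Kz_w[OF that], of 0] w[OF that] by (simp add: s0)
    then obtain B where B: "\<And>t. 0 < t \<Longrightarrow> K x t \<le> B * v t"
      using incl[OF x, of "2 * \<kappa>\<^sup>2"] by blast
    have "real n < 4 * \<kappa>\<^sup>2 * B" for n
    proof -
      let ?M = "M (\<tau> n)" and ?p = "\<lambda>x. K x (\<tau> n)"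
      have t: "0 < \<tau> n" "0 < v (\<tau> n)" using \<tau> v by auto
      have \<delta>n: "0 < \<delta> ^ n" using \<delta>0 by simp
      have "0 \<le> ?M"
        using M_upper[OF \<open>0 \<in> U\<close> t(1)] zero t by simp
      have "\<delta> ^ n * (?M / 2) / \<kappa> \<le> \<delta> ^ n * ?p (y n) / \<kappa>"
        using half[of n] \<delta>n \<kappa> by (intro divide_right_mono mult_left_mono) auto
      also have "\<dots> \<le> ?p (s (Suc n))"
        by (rule low)
      also have "\<dots> \<le> \<kappa> * (?p x + ?p (x - s (Suc n)))"
        using quasi_seminorm_diff_le[OF p[of "\<tau> n"], of x "x - s (Suc n)"] t x s
        by (simp add: subspace_diff subspace_S)
      also have "\<dots> \<le> \<kappa> * (?p x + 2 * \<kappa>\<^sup>2 * ?M * \<delta> ^ Suc n)"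
        using \<kappa> by (intro mult_left_mono add_left_mono tail t \<open>0 \<le> ?M\<close> Kz_M) auto
      also have "2 * \<kappa>\<^sup>2 * ?M * \<delta> ^ Suc n = \<delta> ^ n * ?M / (4 * \<kappa>\<^sup>2)"
        using \<kappa> by (simp add: \<delta>_def power2_eq_square eval_nat_numeral field_simps)
      finally have "\<delta> ^ n * (?M / 2) / \<kappa> \<le> \<kappa> * (?p x + \<delta> ^ n * ?M / (4 * \<kappa>\<^sup>2))" .
      then have "\<delta> ^ n * ?M \<le> 4 * \<kappa>\<^sup>2 * ?p x"
        using \<kappa> by (simp add: field_simps power2_eq_square)
      moreover have "\<delta> ^ n * (real n / \<delta> ^ n * v (\<tau> n)) < \<delta> ^ n * ?M"
        using big[of n] \<delta>n by (rule mult_strict_left_mono)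
      moreover have "4 * \<kappa>\<^sup>2 * ?p x \<le> 4 * \<kappa>\<^sup>2 * (B * v (\<tau> n))"
        using B[OF t(1)] by (intro mult_left_mono) auto
      ultimately have "real n * v (\<tau> n) < 4 * \<kappa>\<^sup>2 * B * v (\<tau> n)"
        using \<delta>0 by (simp add: mult.assoc)
      then show ?thesis using t by simp
    qed
    then show False
      by (meson reals_Archimedean2 order.asym)
  qed
  then obtain C where C: "\<And>t. 0 < t \<Longrightarrow> M t \<le> C * v t" by blast
  \<comment> \<open>By homogeneity the case \<open>B = 1\<close> suffices. \<open>B = 0\<close> is
    separate because of the division by \<open>B\<close>; the maximum with 1 makes the constant
    positive.\<close>
  have "K x t \<le> max 1 C * B * v t"
    if x: "x \<in> S" and le: "\<And>t. 0 < t \<Longrightarrow> K x t \<le> B * w t" and t: "0 < t" for x B t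
  proof -
    have "0 \<le> B * w t" using le[OF t] K_nonneg[OF x, of t] t by simp
    then have "0 \<le> B" using w[OF t] by (simp add: zero_le_mult_iff)
    show ?thesis
    proof (cases "B = 0")
      case True
      then show ?thesis using le[OF t] by simp
    next
      case False
      with \<open>0 \<le> B\<close> have B: "0 < B" by simp
      have "inverse B *\<^sub>R x \<in> U"
        using x le B K_scale[OF x] by (auto simp: U_def subspace_scale subspace_S field_simps)
      then have "inverse B * K x t \<le> M t"
        using M_upper[OF _ t, of "inverse B *\<^sub>R x"] K_scale[OF x, of t "inverse B"] t B by simp
      also have "\<dots> \<le> C * v t" by (rule C[OF t])
      also have "\<dots> \<le> max 1 C * v t" using v[OF t] by (intro mult_right_mono) auto
      finally show ?thesis using B by (simp add: field_simps)
    qed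
  qed
  then show thesis by (intro that[of "max 1 C"]) auto
qed

section \<open>Consequences of good approximation\<close>

text \<open>At the given \<open>t\<close> each \<open>x\<close> in \<open>V\<close> splits into a
  piece in \<open>A0\<close> and a remainder whose \<open>K\<close> at 1 is at most
  \<open>\<delta>\<close> times the bound for \<open>x\<close>. By \<open>V_diff\<close> the
  remainder is again in \<open>V\<close>, so the splitting can be repeated, and the pieces sum to
  \<open>x\<close> in \<open>A0\<close>. It is applied with \<open>V\<close> the whole sum and with
  \<open>V\<close> the intersection.\<close>

lemma approximable_imp_carr0:
  assumes p0: "quasi_seminorm \<kappa> (carr A0) (qnorm A0)" and V: "V \<subseteq> S"
    and V_diff: "\<And>x a. x \<in> V \<Longrightarrow> a \<in> carr A0 \<Longrightarrow> x - a \<in> carr A1 \<Longrightarrow> x - a \<in> V"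
    and t: "0 < t" and \<epsilon>: "0 \<le> \<epsilon>" "4 * \<kappa> * \<epsilon> \<le> 1"
    and le: "\<And>x. x \<in> V \<Longrightarrow> K x t \<le> \<epsilon> * t * K x 1"
  obtains M where "\<And>x. x \<in> V \<Longrightarrow> x \<in> carr A0 \<and> qnorm A0 x \<le> M * K x 1"
proof -
  have \<kappa>: "1 \<le> \<kappa>" by (rule quasi_seminorm_ge1[OF p0])
  \<comment> \<open>The largest ratio the series lemmas allow. It is at least
    \<open>2 * \<epsilon>\<close>, which leaves room for the strict inequality that
    \<open>K_decomp\<close> requires.\<close>
  define \<delta> where "\<delta> = 1 / (2 * \<kappa>)"
  have \<delta>: "0 < \<delta>" "\<kappa> * \<delta> \<le> 1/2" "\<delta> < 1" and \<epsilon>\<delta>: "\<epsilon> \<le> \<delta> / 2"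
    using \<kappa> \<epsilon> by (auto simp: \<delta>_def field_simps)
  have main: "x \<in> carr A0 \<and> qnorm A0 x \<le> 2 * \<kappa>\<^sup>2 * (\<delta> * t) * K x 1" if x: "x \<in> V" for x
  proof (cases "K x 1 = 0")
    case True
    then have "x = 0" using K_eq_0_imp x V by blast
    then show ?thesis using True zero0 subspace_0[OF subspace0] by simp
  next
    case False
    then have N: "0 < K x 1" using K_nonneg[of x 1] x V by force
    define N where "N = K x 1"
    \<comment> \<open>\<open>s n\<close> is the remainder after \<open>n\<close> splittings, and
      \<open>s n - s (Suc n)\<close> is the piece in \<open>A0\<close> split off next.\<close>
    have "\<exists>s. \<forall>n. (s n \<in> V \<and> K (s n) 1 \<le> N * \<delta> ^ n \<and> (n = 0 \<longrightarrow> s n = x)) \<and>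
        (s n - s (Suc n) \<in> carr A0 \<and> qnorm A0 (s n - s (Suc n)) \<le> (\<delta> * t * N) * \<delta> ^ n)"
    proof (rule dependent_nat_choice)
      show "\<exists>s. s \<in> V \<and> K s 1 \<le> N * \<delta> ^ 0 \<and> ((0::nat) = 0 \<longrightarrow> s = x)"
        using x by (auto simp: N_def)
      fix s and n :: nat assume s: "s \<in> V \<and> K s 1 \<le> N * \<delta> ^ n \<and> (n = 0 \<longrightarrow> s = x)"
      have "K s t \<le> \<epsilon> * t * K s 1" using le s by blast
      also have "\<dots> \<le> \<delta> / 2 * t * (N * \<delta> ^ n)"
        using s \<epsilon> \<epsilon>\<delta> t K_nonneg[of s 1] V \<delta> by (intro mult_mono) auto
      also have "\<dots> < \<delta> * t * (N * \<delta> ^ n)"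
        using \<delta> t N by (simp add: N_def)
      finally obtain a b where ab: "a \<in> carr A0" "b \<in> carr A1" "s = a + b"
        "qnorm A0 a + t * qnorm A1 b < \<delta> * t * (N * \<delta> ^ n)"
        using K_decomp[of s t] s V by blast
      have nn: "0 \<le> qnorm A0 a" "0 \<le> t * qnorm A1 b"
        using ab nonneg0 nonneg1 t by auto
      have "t * qnorm A1 b \<le> t * (N * \<delta> ^ Suc n)"
        using ab nn by (simp add: algebra_simps)
      then have b: "qnorm A1 b \<le> N * \<delta> ^ Suc n"
        using t by simp
      have "b \<in> V" using V_diff[of s a] s ab by simp
      moreover have "K b 1 \<le> N * \<delta> ^ Suc n"
        using K_le_carr1[OF ab(2), of 1] b by simp
      moreover have "s - b = a" using ab by simp
      ultimately show "\<exists>s'. (s' \<in> V \<and> K s' 1 \<le> N * \<delta> ^ Suc n \<and> (Suc n = 0 \<longrightarrow> s' = x)) \<and>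
          (s - s' \<in> carr A0 \<and> qnorm A0 (s - s') \<le> (\<delta> * t * N) * \<delta> ^ n)"
        using ab nn by (intro exI[of _ b]) (simp add: algebra_simps)
    qed
    then obtain s where s: "\<And>n. s n \<in> V" "\<And>n. K (s n) 1 \<le> N * \<delta> ^ n" "s 0 = x"
      and a: "\<And>n. s n - s (Suc n) \<in> carr A0"
      and la: "\<And>n. qnorm A0 (s n - s (Suc n)) \<le> (\<delta> * t * N) * \<delta> ^ n"
      by metis
    have c: "0 \<le> \<delta> * t * N" using \<delta> t N by (simp add: N_def)
    have sums: "(\<Sum>m<n. s m - s (Suc m)) = x - s n" for n
      by (simp add: sum_lessThan_telescope' s)
    obtain a where a0: "a \<in> carr A0" and lim: "(\<lambda>n. qnorm A0 ((\<Sum>m<n. s m - s (Suc m)) - a)) \<longlonglongrightarrow> 0"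
      using quasi_banach_geometric_series[OF banach0 p0 a _ \<delta>(2) c la] \<delta> by auto
    have bound: "qnorm A0 (a - 0) \<le> 2 * \<kappa>\<^sup>2 * (\<delta> * t * N) * \<delta> ^ 0"
      using quasi_seminorm_series_tail[OF p0 a a0 _ \<delta>(2) c la lim, of 0] \<delta> by simp
    have inS: "x - s n \<in> carr A0" for n
      unfolding sums[symmetric] using a by (intro subspace_sum subspace0)
    \<comment> \<open>The partial sums \<open>x - s n\<close> tend to \<open>x\<close> in the sum
      because the remainders vanish, and to \<open>a\<close> because they do so in
      \<open>A0\<close>.\<close>
    have "x = a"
    proof (rule K_limit_unique)
      show "x - s n \<in> S" for n using inS carr0_sub by blast
      show "x \<in> S" "a \<in> S" using x V a0 carr0_sub by auto
      have Sn: "s n \<in> S" for n using s V by blast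
      have "(\<lambda>n. K (s n) 1) \<longlonglongrightarrow> 0"
      proof (rule tendsto_sandwich[OF _ _ tendsto_const])
        show "(\<lambda>n. N * \<delta> ^ n) \<longlonglongrightarrow> 0"
          using \<delta> by (auto intro!: tendsto_eq_intros LIMSEQ_power_zero)
      qed (use s K_nonneg[OF Sn] in auto)
      moreover have "K (x - s n - x) 1 = K (s n) 1" for n
        using K_scale[OF Sn, of 1 "-1" n] by simp
      ultimately show "(\<lambda>n. K (x - s n - x) 1) \<longlonglongrightarrow> 0" by simp
      have d: "x - s n - a \<in> carr A0" for n
        using subspace_diff[OF subspace0 inS a0] .
      show "(\<lambda>n. K (x - s n - a) 1) \<longlonglongrightarrow> 0"
      proof (rule tendsto_sandwich[OF _ _ tendsto_const])
        show "(\<lambda>n. qnorm A0 (x - s n - a)) \<longlonglongrightarrow> 0" using lim by (simp add: sums)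
        show "\<forall>\<^sub>F n in sequentially. 0 \<le> K (x - s n - a) 1"
          using d carr0_sub by (intro always_eventually allI K_nonneg) auto
        show "\<forall>\<^sub>F n in sequentially. K (x - s n - a) 1 \<le> qnorm A0 (x - s n - a)"
          using K_le_carr0[OF d] by simp
      qed
    qed
    then show ?thesis
      using bound a0 by (simp add: N_def mult.assoc)
  qed
  show thesis using main by (rule that)
qed

section \<open>Exchanging the roles of the two spaces\<close>

lemma swap: "quasi_couple A1 A0"
  using couple by unfold_locales (auto simp: quasi_banach_couple_def)

lemma sum_carr_swap: "carr (sum_space A1 A0) = S"
  by (auto simp: sum_space_def) (metis add.commute)+

lemma K_swap:
  assumes "x \<in> S" "0 < t"
  shows "K_fun A1 A0 x t = t * K x (1 / t)"
proof (rule antisym)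
  interpret sw: quasi_couple A1 A0 by (rule swap)
  have "K_fun A1 A0 x t / t \<le> K x (1 / t)"
  proof (rule K_ge[OF assms(1)])
    fix a0 a1 assume "a0 \<in> carr A0" "a1 \<in> carr A1" "x = a0 + a1"
    then have "K_fun A1 A0 x t \<le> qnorm A1 a1 + t * qnorm A0 a0"
      using sw.K_le[of a1 a0 t] assms by (simp add: add.commute)
    then show "K_fun A1 A0 x t / t \<le> qnorm A0 a0 + 1 / t * qnorm A1 a1"
      using assms by (simp add: field_simps)
  qed
  then show "K_fun A1 A0 x t \<le> t * K x (1 / t)"
    using assms by (simp add: field_simps)
  show "t * K x (1 / t) \<le> K_fun A1 A0 x t"
  proof (rule sw.K_ge)
    show "x \<in> carr (sum_space A1 A0)" using assms sum_carr_swap by simp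
    fix a1 a0 assume "a1 \<in> carr A1" "a0 \<in> carr A0" "x = a1 + a0"
    then have "K x (1 / t) \<le> qnorm A0 a0 + 1 / t * qnorm A1 a1"
      using K_le[of a0 a1 "1 / t"] assms by (simp add: add.commute)
    then show "t * K x (1 / t) \<le> qnorm A1 a1 + t * qnorm A0 a0"
      using assms by (simp add: field_simps)
  qed
qed

text \<open>The previous approximation result for the reversed couple at \<open>1 / t\<close>. By
  \<open>K_swap\<close> the factor \<open>1 / t\<close> appears on both sides of its hypothesis and
  cancels.\<close>

lemma approximable_imp_carr1:
  assumes p1: "quasi_seminorm \<kappa> (carr A1) (qnorm A1)" and V: "V \<subseteq> S"
    and V_diff: "\<And>x a. x \<in> V \<Longrightarrow> a \<in> carr A1 \<Longrightarrow> x - a \<in> carr A0 \<Longrightarrow> x - a \<in> V"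
    and t: "0 < t" and \<epsilon>: "0 \<le> \<epsilon>" "4 * \<kappa> * \<epsilon> \<le> 1"
    and le: "\<And>x. x \<in> V \<Longrightarrow> K x t \<le> \<epsilon> * K x 1"
  obtains M where "\<And>x. x \<in> V \<Longrightarrow> x \<in> carr A1 \<and> qnorm A1 x \<le> M * K x 1"
proof -
  interpret sw: quasi_couple A1 A0 by (rule swap)
  have "K_fun A1 A0 x (1 / t) \<le> \<epsilon> * (1 / t) * K_fun A1 A0 x 1" if "x \<in> V" for x
    using le[OF that] K_swap[of x "1 / t"] K_swap[of x 1] that V t by (auto simp: field_simps)
  then obtain M where "\<And>x. x \<in> V \<Longrightarrow> x \<in> carr A1 \<and> qnorm A1 x \<le> M * K_fun A1 A0 x 1"
    using sw.approximable_imp_carr0[OF p1 _ V_diff _ \<epsilon>, of "1 / t"] V t sum_carr_swap by auto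
  then show thesis
    using K_swap[of _ 1] V that[of M] by (metis div_by_1 mult_1 subsetD zero_less_one)
qed

section \<open>The interpolation norm\<close>

text \<open>A weighted geometric mean of \<open>min 1 t\<close>, the bound for \<open>K\<close> on
  the intersection, and \<open>max 1 t\<close>, the bound on the sum. Multiplied by
  \<open>t powr (- \<theta>)\<close> it decays at 0 and at infinity when \<open>\<eta>\<close> is
  below both \<open>\<theta>\<close> and \<open>1 - \<theta>\<close>.\<close>

definition wt :: "real \<Rightarrow> real \<Rightarrow> real" where
  "wt \<eta> t = min 1 t powr (1 - \<eta>) * max 1 t powr \<eta>"

lemma wt_pos: "0 < t \<Longrightarrow> 0 < wt \<eta> t"
  by (simp add: wt_def)

lemma wt_le_1: "0 < t \<Longrightarrow> t \<le> 1 \<Longrightarrow> t powr (- \<theta>) * wt \<eta> t = t powr (1 - \<eta> - \<theta>)"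
  by (simp add: wt_def flip: powr_add)

lemma wt_ge_1: "1 \<le> t \<Longrightarrow> t powr (- \<theta>) * wt \<eta> t = t powr (\<eta> - \<theta>)"
  by (simp add: wt_def flip: powr_add)

text \<open>The integrand is \<open>t powr (\<alpha> - 1)\<close> up to 1 and
  \<open>t powr (\<beta> - 1)\<close> from 1 on, with \<open>\<beta> < 0 < \<alpha>\<close>. In the
  majorant both indicators contain 1, which is harmless for an upper bound.\<close>

lemma nn_integral_wt_finite:
  assumes \<eta>: "\<eta> < \<theta>" "\<eta> < 1 - \<theta>" and r: "0 < r"
  shows "(\<integral>\<^sup>+t\<in>{0<..}. ennreal ((t powr (- \<theta>) * wt \<eta> t) powr r / t) \<partial>lborel) < \<infinity>"
proof -
  define \<alpha> where "\<alpha> = (1 - \<eta> - \<theta>) * r"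
  define \<beta> where "\<beta> = (\<eta> - \<theta>) * r"
  have \<alpha>: "0 < \<alpha>" and \<beta>: "\<beta> < 0"
    using assms by (auto simp: \<alpha>_def \<beta>_def mult_neg_pos)
  have "(\<integral>\<^sup>+t\<in>{0<..}. ennreal ((t powr (- \<theta>) * wt \<eta> t) powr r / t) \<partial>lborel)
      \<le> (\<integral>\<^sup>+t. ennreal (indicator {0..1} t * t powr (\<alpha> - 1)) + ennreal (indicator {1..} t * t powr (\<beta> - 1)) \<partial>lborel)"
  proof (rule nn_integral_mono)
    fix t :: real
    show "ennreal ((t powr (- \<theta>) * wt \<eta> t) powr r / t) * indicator {0<..} t
      \<le> ennreal (indicator {0..1} t * t powr (\<alpha> - 1)) + ennreal (indicator {1..} t * t powr (\<beta> - 1))"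
    proof (cases "0 < t")
      case True
      consider "t \<le> 1" | "1 \<le> t" by linarith
      then show ?thesis
      proof cases
        case 1
        have "(t powr (- \<theta>) * wt \<eta> t) powr r / t = t powr (\<alpha> - 1)"
          using True by (simp only: wt_le_1[OF True 1] powr_powr flip: \<alpha>_def) (simp add: powr_diff)
        then show ?thesis using True 1 by simp
      next
        case 2
        have "(t powr (- \<theta>) * wt \<eta> t) powr r / t = t powr (\<beta> - 1)"
          using True by (simp only: wt_ge_1[OF 2] powr_powr flip: \<beta>_def) (simp add: powr_diff)
        then show ?thesis using 2 by (simp add: add_increasing)
      qed
    qed simp
  qed
  also have "\<dots> = (\<integral>\<^sup>+t. ennreal (indicator {0..1} t * t powr (\<alpha> - 1)) \<partial>lborel)
      + (\<integral>\<^sup>+t. ennreal (indicator {1..} t * t powr (\<beta> - 1)) \<partial>lborel)"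
    by (rule nn_integral_add) auto
  also have "(\<integral>\<^sup>+t. ennreal (indicator {0..1} t * t powr (\<alpha> - 1)) \<partial>lborel) = ennreal (1 powr (\<alpha> - 1 + 1) / (\<alpha> - 1 + 1))"
    using \<alpha> by (intro nn_integral_has_integral_lebesgue has_integral_powr_from_0) auto
  also have "(\<integral>\<^sup>+t. ennreal (indicator {1..} t * t powr (\<beta> - 1)) \<partial>lborel) = ennreal (- (1 powr (\<beta> - 1 + 1)) / (\<beta> - 1 + 1))"
    using \<beta> by (intro nn_integral_has_integral_lebesgue has_integral_powr_to_inf) auto
  finally show ?thesis
    by (rule le_less_trans) simp
qed

text \<open>The inner half of the sandwich: for every \<open>q\<close> the class of
  \<open>wt \<eta>\<close> lies in the interpolation space, with a norm bound.\<close>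

lemma interp_norm_le_of_K_le:
  assumes \<eta>: "\<eta> < \<theta>" "\<eta> < 1 - \<theta>" and q: "0 < q"
  obtains C where "0 < C"
    "\<And>x B. x \<in> S \<Longrightarrow> (\<And>t. 0 < t \<Longrightarrow> K x t \<le> B * wt \<eta> t) \<Longrightarrow> interp_norm A0 A1 \<theta> q x \<le> ennreal (C * B)"
proof -
  have B_nonneg: "0 \<le> B" if "x \<in> S" "\<And>t. 0 < t \<Longrightarrow> K x t \<le> B * wt \<eta> t" for x B
    using that(2)[of 1] K_nonneg[OF that(1), of 1] by (simp add: wt_def)
  show thesis
  proof (cases "q = \<infinity>")
    case True
    show thesis
    proof (rule that[of 1])
      fix x B assume x: "x \<in> S" and le: "\<And>t. 0 < t \<Longrightarrow> K x t \<le> B * wt \<eta> t"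
      have "t powr (- \<theta>) * K x t \<le> 1 * B" if "0 < t" for t
      proof -
        have "t powr (- \<theta>) * wt \<eta> t \<le> 1"
        proof (cases "t \<le> 1")
          case True
          then show ?thesis using \<eta> that by (simp add: wt_le_1 powr_le1)
        next
          case False
          then show ?thesis using \<eta> powr_mono[of "\<eta> - \<theta>" 0 t] by (simp add: wt_ge_1)
        qed
        then have "(t powr (- \<theta>) * wt \<eta> t) * B \<le> 1 * B"
          using B_nonneg[OF x le] by (intro mult_right_mono) auto
        moreover have "t powr (- \<theta>) * K x t \<le> t powr (- \<theta>) * (B * wt \<eta> t)"
          using le[OF that] by (intro mult_left_mono) auto
        ultimately show ?thesis by (simp add: mult_ac)
      qed
      then show "interp_norm A0 A1 \<theta> q x \<le> ennreal (1 * B)"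
        using True by (auto simp: interp_norm_def intro!: SUP_least ennreal_leI)
    qed simp
  next
    case False
    define r where "r = enn2real q"
    have r: "0 < r"
      using q False by (auto simp: r_def enn2real_positive_iff top.not_eq_extremum)
    define J where "J = (\<integral>\<^sup>+t\<in>{0<..}. ennreal ((t powr (- \<theta>) * wt \<eta> t) powr r / t) \<partial>lborel)"
    define j where "j = enn2real J"
    have J: "J = ennreal j" and j: "0 \<le> j"
      using nn_integral_wt_finite[OF \<eta> r] by (auto simp: J_def j_def)
    \<comment> \<open>Only \<open>0 \<le> j\<close> has been established, so 1 is added to obtain a
      positive constant.\<close>
    have "interp_norm A0 A1 \<theta> q x \<le> ennreal ((j powr (1 / r) + 1) * B)"
      if x: "x \<in> S" and le: "\<And>t. 0 < t \<Longrightarrow> K x t \<le> B * wt \<eta> t" for x B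
    proof -
      have B: "0 \<le> B" by (rule B_nonneg[OF x le])
      define I where "I = (\<integral>\<^sup>+t\<in>{0<..}. ennreal ((t powr (- \<theta>) * K x t) powr r / t) \<partial>lborel)"
      have "I \<le> (\<integral>\<^sup>+t. ennreal (B powr r) * (ennreal ((t powr (- \<theta>) * wt \<eta> t) powr r / t) * indicator {0<..} t) \<partial>lborel)"
        unfolding I_def
      proof (rule nn_integral_mono)
        fix t :: real
        show "ennreal ((t powr (- \<theta>) * K x t) powr r / t) * indicator {0<..} t
          \<le> ennreal (B powr r) * (ennreal ((t powr (- \<theta>) * wt \<eta> t) powr r / t) * indicator {0<..} t)"
        proof (cases "0 < t")
          case True
          have "t powr (- \<theta>) * K x t \<le> B * (t powr (- \<theta>) * wt \<eta> t)"
            using mult_left_mono[OF le[OF True], of "t powr (- \<theta>)"] by (simp add: mult_ac)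
          then have "(t powr (- \<theta>) * K x t) powr r \<le> (B * (t powr (- \<theta>) * wt \<eta> t)) powr r"
            using r True K_nonneg[OF x, of t] by (intro powr_mono2) auto
          also have "\<dots> = B powr r * (t powr (- \<theta>) * wt \<eta> t) powr r"
            by (rule powr_mult)
          finally have "(t powr (- \<theta>) * K x t) powr r / t \<le> B powr r * ((t powr (- \<theta>) * wt \<eta> t) powr r / t)"
            using True by (simp add: divide_right_mono)
          then show ?thesis
            using True by (simp add: ennreal_leI flip: ennreal_mult)
        qed simp
      qed
      also have "\<dots> = ennreal (B powr r) * J"
        unfolding J_def by (rule nn_integral_cmult) (simp add: wt_def)
      also have "\<dots> = ennreal (B powr r * j)"
        by (simp add: J ennreal_mult j)
      finally have I: "I \<le> ennreal (B powr r * j)" .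
      then have fin: "I \<noteq> \<infinity>"
        by (auto simp: top_unique)
      have "enn2real I powr (1 / r) \<le> (B powr r * j) powr (1 / r)"
        using I j r enn2real_mono[OF I] by (intro powr_mono2) auto
      also have "\<dots> = B * j powr (1 / r)"
        using B j r by (simp add: powr_mult powr_powr)
      also have "\<dots> \<le> (j powr (1 / r) + 1) * B"
        using B by (simp add: algebra_simps)
      finally have "enn2real I powr (1 / r) \<le> (j powr (1 / r) + 1) * B" .
      then show ?thesis
        using False fin by (simp add: interp_norm_def Let_def ennreal_leI flip: r_def I_def)
    qed
    then show thesis
      by (intro that[of "j powr (1 / r) + 1"]) (auto simp: add_nonneg_pos)
  qed
qed

text \<open>The outer half of the sandwich. For finite \<open>q\<close>, monotonicity of
  \<open>K\<close> in \<open>t\<close> bounds the integral from below by its part over the interval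
  from \<open>t\<close> to \<open>2 * t\<close>.\<close>

lemma K_le_interp_norm:
  assumes \<theta>: "0 < \<theta>" and q: "0 < q"
  obtains C where "0 < C"
    "\<And>x t. x \<in> carr (interp_space A0 A1 \<theta> q) \<Longrightarrow> 0 < t \<Longrightarrow>
      K x t \<le> C * t powr \<theta> * qnorm (interp_space A0 A1 \<theta> q) x"
proof (cases "q = \<infinity>")
  case True
  show thesis
  proof (rule that[of 1])
    fix x t assume x: "x \<in> carr (interp_space A0 A1 \<theta> q)" and t: "0 < (t::real)"
    have "ennreal (t powr (- \<theta>) * K x t) \<le> interp_norm A0 A1 \<theta> q x"
      using True t by (auto simp: interp_norm_def intro!: SUP_upper)
    then have "t powr (- \<theta>) * K x t \<le> qnorm (interp_space A0 A1 \<theta> q) x"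
      using x t K_nonneg[of x t] enn2real_mono[of "ennreal (t powr (- \<theta>) * K x t)" "interp_norm A0 A1 \<theta> q x"]
      by (auto simp: interp_space_def)
    then show "K x t \<le> 1 * t powr \<theta> * qnorm (interp_space A0 A1 \<theta> q) x"
      using t by (simp add: powr_minus field_simps)
  qed simp
next
  case False
  define r where "r = enn2real q"
  have r: "0 < r"
    using q False by (auto simp: r_def enn2real_positive_iff top.not_eq_extremum)
  show thesis
  proof (rule that[of "2 powr \<theta> * 2 powr (1 / r)"])
    fix x t assume x: "x \<in> carr (interp_space A0 A1 \<theta> q)" and t: "0 < (t::real)"
    then have xS: "x \<in> S" and fin: "interp_norm A0 A1 \<theta> q x < \<infinity>"
      by (auto simp: interp_space_def)
    define I where "I = (\<integral>\<^sup>+t\<in>{0<..}. ennreal ((t powr (- \<theta>) * K x t) powr r / t) \<partial>lborel)"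
    have I: "I \<noteq> \<infinity>" and norm: "qnorm (interp_space A0 A1 \<theta> q) x = enn2real I powr (1 / r)"
      using fin False by (auto simp: interp_norm_def interp_space_def Let_def simp flip: r_def I_def split: if_splits)
    \<comment> \<open>A lower bound for \<open>s powr (- \<theta>) * K x s\<close> throughout that
      interval: the decreasing factor is taken at its right end, the increasing one at its left
      end.\<close>
    define c where "c = (2 * t) powr (- \<theta>) * K x t"
    have c: "0 \<le> c" using K_nonneg[OF xS, of t] t by (simp add: c_def)
    have "ennreal (c powr r / 2) = ennreal (c powr r / (2 * t)) * emeasure lborel {t..2 * t}"
      using t by (simp add: ennreal_mult[symmetric])
    also have "\<dots> = (\<integral>\<^sup>+s\<in>{t..2 * t}. ennreal (c powr r / (2 * t)) \<partial>lborel)"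
      by (rule nn_integral_cmult_indicator[symmetric]) simp
    also have "\<dots> \<le> I"
      unfolding I_def
    proof (rule nn_integral_mono)
      fix s :: real
      show "ennreal (c powr r / (2 * t)) * indicator {t..2 * t} s
        \<le> ennreal ((s powr (- \<theta>) * K x s) powr r / s) * indicator {0<..} s"
      proof (cases "s \<in> {t..2 * t}")
        case True
        then have s: "0 < s" "t \<le> s" "s \<le> 2 * t" using t by auto
        have "c \<le> s powr (- \<theta>) * K x s"
          unfolding c_def using s t \<theta> K_nonneg[OF xS, of t] K_mono[OF xS, of t s]
          by (intro mult_mono powr_mono2') auto
        then have "c powr r / (2 * t) \<le> (s powr (- \<theta>) * K x s) powr r / s"
          using s t r c by (intro frac_le powr_mono2) auto
        then show ?thesis using True s by (simp add: ennreal_leI)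
      qed simp
    qed
    finally have "c powr r / 2 \<le> enn2real I"
      using enn2real_mono[of "ennreal (c powr r / 2)" I] I by (simp add: top.not_eq_extremum)
    then have "(c powr r) powr (1 / r) \<le> (2 * enn2real I) powr (1 / r)"
      using r by (intro powr_mono2) auto
    then have "c \<le> 2 powr (1 / r) * enn2real I powr (1 / r)"
      using c r by (simp add: powr_powr powr_mult)
    moreover have "K x t = (2 * t) powr \<theta> * c"
      using t by (simp add: c_def powr_minus)
    ultimately have "K x t \<le> (2 * t) powr \<theta> * (2 powr (1 / r) * enn2real I powr (1 / r))"
      by (simp add: mult_left_mono)
    then show "K x t \<le> 2 powr \<theta> * 2 powr (1 / r) * t powr \<theta> * qnorm (interp_space A0 A1 \<theta> q) x"
      using t by (simp add: norm powr_mult mult_ac)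
  qed simp
qed

text \<open>Needed for continuity of the inclusion into the sum: the balls of \<open>qtop\<close>
  measure differences, so these must stay in the space.\<close>

lemma interp_diff:
  assumes q: "0 < q"
    and x: "x \<in> carr (interp_space A0 A1 \<theta> q)" and y: "y \<in> carr (interp_space A0 A1 \<theta> q)"
  shows "x - y \<in> carr (interp_space A0 A1 \<theta> q)"
proof -
  have S: "x \<in> S" "y \<in> S" "x - y \<in> S"
    using x y by (auto simp: interp_space_def intro: subspace_diff subspace_S)
  obtain \<kappa> where p: "\<And>t. 0 \<le> t \<Longrightarrow> quasi_seminorm \<kappa> S (\<lambda>x. K x t)"
    using K_quasi_seminorm by blast
  have \<kappa>: "1 \<le> \<kappa>" using quasi_seminorm_ge1[OF p[of 0]] by simp
  define F where "F z t = t powr (- \<theta>) * K z t" for z t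
  have F: "F (x - y) t \<le> \<kappa> * (F x t + F y t)" if "0 < t" for t
    using quasi_seminorm_diff_le[OF p[of t] S(1,2)] that
      mult_left_mono[of "K (x - y) t" "\<kappa> * (K x t + K y t)" "t powr (- \<theta>)"]
    by (simp add: F_def algebra_simps)
  have F0: "0 \<le> F z t" if "z \<in> S" "0 < t" for z t
    using K_nonneg[OF that(1), of t] that by (simp add: F_def)
  have "interp_norm A0 A1 \<theta> q (x - y) < \<infinity>"
  proof (cases "q = \<infinity>")
    case True
    define b where "b z = enn2real (interp_norm A0 A1 \<theta> q z)" for z
    have b: "F z t \<le> b z" if z: "z \<in> S" "interp_norm A0 A1 \<theta> q z < \<infinity>" "0 < t" for z t
    proof -
      have "ennreal (F z t) \<le> interp_norm A0 A1 \<theta> q z"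
        using True z(3) by (auto simp: interp_norm_def F_def intro!: SUP_upper)
      then show ?thesis
        using enn2real_mono[of "ennreal (F z t)" "interp_norm A0 A1 \<theta> q z"] z F0 by (simp add: b_def)
    qed
    have "F (x - y) t \<le> \<kappa> * (b x + b y)" if "0 < t" for t
    proof -
      have "F (x - y) t \<le> \<kappa> * (F x t + F y t)" by (rule F[OF that])
      also have "\<dots> \<le> \<kappa> * (b x + b y)"
        using x y \<kappa> that S by (intro mult_left_mono add_mono b) (auto simp: interp_space_def)
      finally show ?thesis .
    qed
    then have "interp_norm A0 A1 \<theta> q (x - y) \<le> ennreal (\<kappa> * (b x + b y))"
      using True by (auto simp: interp_norm_def F_def intro!: SUP_least ennreal_leI)
    then show ?thesis by (rule le_less_trans) simp
  next
    case False
    define r where "r = enn2real q"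
    have r: "0 < r"
      using q False by (auto simp: r_def enn2real_positive_iff top.not_eq_extremum)
    define I where "I z = (\<integral>\<^sup>+t\<in>{0<..}. ennreal (F z t powr r / t) \<partial>lborel)" for z
    have I_iff: "interp_norm A0 A1 \<theta> q z < \<infinity> \<longleftrightarrow> I z < \<infinity>" for z
      using False by (auto simp: interp_norm_def Let_def I_def F_def less_top simp flip: r_def)
    have meas: "(\<lambda>t. ennreal (F z t powr r / t) * indicator {0<..} t) \<in> borel_measurable lborel"
      if "z \<in> S" for z
    proof -
      \<comment> \<open>Monotonicity of \<open>K\<close> is known for nonnegative arguments;
        truncation at 0 gives a function monotone on the whole line, hence Borel.\<close>
      have "mono (\<lambda>t. K z (max 0 t))"
        using K_mono[OF that] by (intro monoI) auto
      then have [measurable]: "(\<lambda>t. K z (max 0 t)) \<in> borel_measurable borel"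
        by (rule borel_measurable_mono)
      have "(\<lambda>t. ennreal ((t powr (- \<theta>) * K z (max 0 t)) powr r / t) * indicator {0<..} t) \<in> borel_measurable lborel"
        by measurable
      also have "(\<lambda>t. ennreal ((t powr (- \<theta>) * K z (max 0 t)) powr r / t) * indicator {0<..} t)
          = (\<lambda>t. ennreal (F z t powr r / t) * indicator {0<..} t)"
        by (auto simp: F_def fun_eq_iff indicator_def)
      finally show ?thesis .
    qed
    have "I (x - y) \<le> (\<integral>\<^sup>+t. ennreal ((2 * \<kappa>) powr r) * (ennreal (F x t powr r / t) * indicator {0<..} t
        + ennreal (F y t powr r / t) * indicator {0<..} t) \<partial>lborel)"
      unfolding I_def
    proof (rule nn_integral_mono)
      fix t :: real
      show "ennreal (F (x - y) t powr r / t) * indicator {0<..} t \<le> ennreal ((2 * \<kappa>) powr r) *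
          (ennreal (F x t powr r / t) * indicator {0<..} t + ennreal (F y t powr r / t) * indicator {0<..} t)"
      proof (cases "0 < t")
        case True
        \<comment> \<open>Replacing both terms by their maximum treats \<open>r < 1\<close> and
          \<open>r \<ge> 1\<close> alike, without convexity.\<close>
        define m where "m = max (F x t) (F y t)"
        have m: "0 \<le> m" using F0[OF S(1) True] by (simp add: m_def)
        have "\<kappa> * (F x t + F y t) \<le> \<kappa> * (m + m)"
          using \<kappa> by (intro mult_left_mono add_mono) (auto simp: m_def)
        then have "F (x - y) t \<le> 2 * \<kappa> * m"
          using F[OF True] by simp
        then have "F (x - y) t powr r \<le> (2 * \<kappa> * m) powr r"
          using F0[OF S(3) True] r by (intro powr_mono2) auto
        also have "\<dots> = (2 * \<kappa>) powr r * m powr r"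
          by (rule powr_mult)
        also have "\<dots> \<le> (2 * \<kappa>) powr r * (F x t powr r + F y t powr r)"
          by (intro mult_left_mono) (auto simp: m_def max_def)
        finally have "F (x - y) t powr r / t \<le> (2 * \<kappa>) powr r * (F x t powr r / t + F y t powr r / t)"
          using True by (simp add: field_simps)
        then show ?thesis
          using True by (simp add: ennreal_leI flip: ennreal_mult ennreal_plus)
      qed simp
    qed
    also have "\<dots> = ennreal ((2 * \<kappa>) powr r) * (I x + I y)"
      using meas S unfolding I_def by (simp add: nn_integral_cmult nn_integral_add)
    also have "\<dots> < \<infinity>"
      using x y I_iff[of x] I_iff[of y] by (simp add: interp_space_def ennreal_mult_less_top)
    finally show ?thesis
      unfolding I_iff .
  qed
  then show ?thesis
    using S by (simp add: interp_space_def)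
qed

lemma inter_carr: "carr (inter_space A0 A1) = carr A0 \<inter> carr A1"
  by (simp add: inter_space_def)

lemma K_le_inter:
  assumes "x \<in> carr (inter_space A0 A1)" "0 < t"
  shows "K x t \<le> qnorm (inter_space A0 A1) x * min 1 t"
proof -
  define m where "m = qnorm (inter_space A0 A1) x"
  have m: "qnorm A0 x \<le> m" "qnorm A1 x \<le> m"
    by (simp_all add: m_def inter_space_def)
  have "K x t \<le> m"
    using assms K_le_carr0[of x t] m by (simp add: inter_carr)
  moreover have "K x t \<le> t * qnorm A1 x"
    using assms K_le_carr1[of x t] by (simp add: inter_carr)
  then have "K x t \<le> t * m"
    using assms m by (meson order_trans mult_left_mono less_imp_le)
  ultimately show ?thesis
    by (simp add: m_def min_def mult.commute)
qed

lemma wt_0: "0 < t \<Longrightarrow> wt 0 t = min 1 t"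
  by (simp add: wt_def)

lemma interp_carr:
  "x \<in> carr (interp_space A0 A1 \<theta> q) \<longleftrightarrow> x \<in> S \<and> interp_norm A0 A1 \<theta> q x < \<infinity>"
  by (simp add: interp_space_def)

lemma interp_carrI:
  assumes "x \<in> S" "interp_norm A0 A1 \<theta> q x \<le> ennreal c"
  shows "x \<in> carr (interp_space A0 A1 \<theta> q)"
  using assms le_less_trans[OF assms(2) ennreal_less_top] by (simp add: interp_space_def)

section \<open>The two continuous inclusions\<close>

lemma bounded_imp_continuously_included:
  assumes "carr A \<subseteq> carr B" "\<And>x y. x \<in> carr A \<Longrightarrow> y \<in> carr A \<Longrightarrow> x - y \<in> carr A"
    and "0 < C" "\<And>x. x \<in> carr A \<Longrightarrow> qnorm B x \<le> C * qnorm A x"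
  shows "A \<hookrightarrow> B"
  unfolding continuously_included_def continuous_map_def topspace_qtop
proof (intro conjI allI impI assms(1))
  show "(\<lambda>x. x) \<in> carr A \<rightarrow> carr B" using assms(1) by auto
  fix U assume U: "openin (qtop B) U"
  show "openin (qtop A) {x \<in> carr A. x \<in> U}"
    unfolding openin_qtop
  proof (intro conjI ballI)
    fix x assume x: "x \<in> {x \<in> carr A. x \<in> U}"
    then obtain r where r: "r > 0" "{y \<in> carr B. qnorm B (y - x) < r} \<subseteq> U"
      using U by (auto simp: openin_qtop)
    have "y \<in> U" if y: "y \<in> carr A" "qnorm A (y - x) < r / C" for y
    proof -
      have "qnorm B (y - x) \<le> C * qnorm A (y - x)"
        using assms(2,4) x y by auto
      also have "\<dots> < r"
        using y \<open>0 < C\<close> by (simp add: field_simps)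
      finally show ?thesis using r y assms(1) by auto
    qed
    then show "\<exists>r>0. {y \<in> carr A. qnorm A (y - x) < r} \<subseteq> {x \<in> carr A. x \<in> U}"
      using r \<open>0 < C\<close> by (intro exI[of _ "r / C"]) auto
  qed auto
qed

text \<open>On the intersection \<open>K x t\<close> is at most the norm times
  \<open>min 1 t\<close>, which is \<open>wt 0 t\<close>; the inner half of the sandwich applies
  with \<open>\<eta> = 0\<close>.\<close>

lemma inter_included_interp:
  assumes "0 < \<theta>" "\<theta> < 1" "0 < q"
  shows "inter_space A0 A1 \<hookrightarrow> interp_space A0 A1 \<theta> q"
proof -
  obtain C where C: "0 < C" and le: "\<And>x B. x \<in> S \<Longrightarrow> (\<And>t. 0 < t \<Longrightarrow> K x t \<le> B * wt 0 t) \<Longrightarrow>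
      interp_norm A0 A1 \<theta> q x \<le> ennreal (C * B)"
    using interp_norm_le_of_K_le[of 0 \<theta> q] assms by auto
  have norm: "interp_norm A0 A1 \<theta> q x \<le> ennreal (C * qnorm (inter_space A0 A1) x)"
    and S: "x \<in> S" if "x \<in> carr (inter_space A0 A1)" for x
  proof -
    show "x \<in> S" using that carr0_sub by (auto simp: inter_carr)
    then show "interp_norm A0 A1 \<theta> q x \<le> ennreal (C * qnorm (inter_space A0 A1) x)"
      using K_le_inter[OF that] by (intro le) (auto simp: wt_0)
  qed
  show ?thesis
  proof (rule bounded_imp_continuously_included[OF _ _ C])
    show "carr (inter_space A0 A1) \<subseteq> carr (interp_space A0 A1 \<theta> q)"
      using norm S interp_carrI by blast
    show "x - y \<in> carr (inter_space A0 A1)"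
      if "x \<in> carr (inter_space A0 A1)" "y \<in> carr (inter_space A0 A1)" for x y
      using that by (auto simp: inter_carr subspace_diff subspace0 subspace1)
    show "qnorm (interp_space A0 A1 \<theta> q) x \<le> C * qnorm (inter_space A0 A1) x"
      if x: "x \<in> carr (inter_space A0 A1)" for x
    proof -
      have "0 \<le> qnorm (inter_space A0 A1) x"
        using nonneg0[of x] x by (auto simp: inter_space_def le_max_iff_disj)
      then show ?thesis
        using enn2real_mono[OF norm[OF x]] C by (simp add: interp_space_def)
    qed
  qed
qed

lemma interp_included_sum:
  assumes "0 < \<theta>" "0 < q"
  shows "interp_space A0 A1 \<theta> q \<hookrightarrow> sum_space A0 A1"
proof -
  obtain C where C: "0 < C" and le: "\<And>x t. x \<in> carr (interp_space A0 A1 \<theta> q) \<Longrightarrow> 0 < t \<Longrightarrow>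
      K x t \<le> C * t powr \<theta> * qnorm (interp_space A0 A1 \<theta> q) x"
    by (rule K_le_interp_norm[OF assms]) (rule that, auto)
  show ?thesis
    \<comment> \<open>The value \<open>t = 1\<close> suffices, since the quasi-norm of the sum is
      \<open>K x 1\<close>.\<close>
    using le[of _ 1] interp_diff[OF assms(2)]
    by (intro bounded_imp_continuously_included[OF _ _ C]) (auto simp: interp_carr sum_qnorm)
qed

section \<open>Coincidence with the sum\<close>

lemma exists_powr_small:
  assumes "0 < (a::real)" "0 < \<epsilon>"
  shows "\<exists>t>0. t \<le> 1 \<and> t powr a \<le> \<epsilon>"
proof (intro exI[of _ "min 1 (\<epsilon> powr (1 / a))"] conjI)
  have "min 1 (\<epsilon> powr (1 / a)) powr a \<le> (\<epsilon> powr (1 / a)) powr a"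
    using assms by (intro powr_mono2) auto
  then show "min 1 (\<epsilon> powr (1 / a)) powr a \<le> \<epsilon>"
    using assms by (simp add: powr_powr)
qed (use assms in auto)

text \<open>Statement (a) in contrapositive form. The sum is the class of \<open>max 1\<close>, so
  equality places this class inside that of \<open>t powr \<theta>\<close>, and the uniform bound
  makes \<open>K\<close> small relative to \<open>K x 1\<close> for small \<open>t\<close>, and
  relative to \<open>t * K x 1\<close> for large \<open>t\<close>.\<close>

lemma interp_eq_sum_imp:
  assumes \<theta>: "0 < \<theta>" "\<theta> < 1" and q: "0 < q"
    and eq: "carr (interp_space A0 A1 \<theta> q) = S"
  shows "carr A0 = S \<and> carr A1 = S"
proof -
  obtain \<kappa> where p0: "quasi_seminorm \<kappa> (carr A0) (qnorm A0)" and p1: "quasi_seminorm \<kappa> (carr A1) (qnorm A1)"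
    by (rule K_quasi_seminorm)
  have \<kappa>: "1 \<le> \<kappa>" by (rule quasi_seminorm_ge1[OF p0])
  define \<epsilon> where "\<epsilon> = 1 / (4 * \<kappa>)"
  have \<epsilon>: "0 < \<epsilon>" "4 * \<kappa> * \<epsilon> \<le> 1" using \<kappa> by (auto simp: \<epsilon>_def)
  obtain D where "0 < D" and D: "\<And>x t. x \<in> carr (interp_space A0 A1 \<theta> q) \<Longrightarrow> 0 < t \<Longrightarrow>
      K x t \<le> D * t powr \<theta> * qnorm (interp_space A0 A1 \<theta> q) x"
    by (rule K_le_interp_norm[OF \<theta>(1) q]) (rule that, auto)
  obtain C where C: "0 < C" and CB: "\<And>x B t. x \<in> S \<Longrightarrow> (\<And>t. 0 < t \<Longrightarrow> K x t \<le> B * max 1 t) \<Longrightarrow> 0 < t \<Longrightarrow>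
      K x t \<le> C * B * t powr \<theta>"
  proof (rule K_uniform_bound[of "max 1" "\<lambda>t. t powr \<theta>"])
    show "\<exists>B'. \<forall>t>0. K x t \<le> B' * t powr \<theta>" if "x \<in> S" for x
      using D[of x] that eq
      by (intro exI[of _ "D * qnorm (interp_space A0 A1 \<theta> q) x"]) (auto simp: mult_ac)
  qed auto
  have bound: "K x t \<le> C * t powr \<theta> * K x 1" if "x \<in> S" "0 < t" for x t
    using CB[OF that(1) _ that(2), of "K x 1"] K_le_max[OF that(1)] by (simp add: mult_ac)
  obtain t where t: "0 < t" "t \<le> 1" "t powr \<theta> \<le> \<epsilon> / C"
    using exists_powr_small[OF \<theta>(1), of "\<epsilon> / C"] \<epsilon> C by auto
  have small1: "K x t \<le> \<epsilon> * K x 1" if "x \<in> S" for x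
  proof -
    have "C * t powr \<theta> \<le> \<epsilon>" using t C by (simp add: field_simps)
    then show ?thesis
      using bound[OF that t(1)] mult_right_mono[of "C * t powr \<theta>" \<epsilon> "K x 1"] K_nonneg[OF that, of 1]
      by simp
  qed
  obtain M1 where "\<And>x. x \<in> S \<Longrightarrow> x \<in> carr A1 \<and> qnorm A1 x \<le> M1 * K x 1"
  proof (rule approximable_imp_carr1[OF p1 order_refl])
    show "x - a \<in> S" if "x - a \<in> carr A0" for x a using that carr0_sub by blast
    show "0 < t" by (rule t(1))
    show "K x t \<le> \<epsilon> * K x 1" if "x \<in> S" for x by (rule small1[OF that])
  qed (use \<epsilon> in auto)
  then have "S \<subseteq> carr A1" by blast
  obtain u where u: "0 < u" "u \<le> 1" "u powr (1 - \<theta>) \<le> \<epsilon> / C"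
    using exists_powr_small[of "1 - \<theta>" "\<epsilon> / C"] \<theta> \<epsilon> C by auto
  \<comment> \<open>The large argument is written as \<open>1 / u\<close>:
    \<open>(1 / u) powr \<theta>\<close> equals \<open>u powr (1 - \<theta>)\<close> divided by
    \<open>u\<close>, and \<open>\<theta> < 1\<close> makes the first factor small.\<close>
  have small0: "K x (1 / u) \<le> \<epsilon> * (1 / u) * K x 1" if "x \<in> S" for x
  proof -
    have "C * (1 / u) powr \<theta> = C * u powr (1 - \<theta>) * (1 / u)"
      using u by (simp add: powr_diff powr_divide)
    also have "\<dots> \<le> \<epsilon> * (1 / u)"
      using u C by (intro mult_right_mono) (auto simp: field_simps)
    finally show ?thesis
      using bound[OF that, of "1 / u"] u K_nonneg[OF that, of 1]
        mult_right_mono[of "C * (1 / u) powr \<theta>" "\<epsilon> * (1 / u)" "K x 1"]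
      by simp
  qed
  obtain M0 where "\<And>x. x \<in> S \<Longrightarrow> x \<in> carr A0 \<and> qnorm A0 x \<le> M0 * K x 1"
  proof (rule approximable_imp_carr0[OF p0 order_refl])
    show "x - a \<in> S" if "x - a \<in> carr A1" for x a using that carr1_sub by blast
    show "0 < 1 / u" using u by simp
    show "K x (1 / u) \<le> \<epsilon> * (1 / u) * K x 1" if "x \<in> S" for x by (rule small0[OF that])
  qed (use \<epsilon> in auto)
  then have "S \<subseteq> carr A0" by blast
  with \<open>S \<subseteq> carr A1\<close> show ?thesis
    using carr0_sub carr1_sub by blast
qed

text \<open>Here \<open>N\<close> is the best constant in \<open>K x t \<le> N * min 1 t\<close>; interpolating between this bound
  and \<open>K x t \<le> max 1 t * K x 1\<close> turns the hypothesis into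
  \<open>N \<le> C * N powr (1 - \<eta>) * K x 1 powr \<eta>\<close>, which can be solved for \<open>N\<close>.\<close>

lemma K_bound_self_improve:
  assumes \<eta>: "0 < \<eta>" "\<eta> < 1" and C: "0 < C" and x: "x \<in> carr A0 \<inter> carr A1"
    and CB: "\<And>B t. (\<And>t. 0 < t \<Longrightarrow> K x t \<le> B * wt \<eta> t) \<Longrightarrow> 0 < t \<Longrightarrow> K x t \<le> C * B * min 1 t"
    and t: "0 < t"
  shows "K x t \<le> C powr (1 / \<eta>) * min 1 t * K x 1"
proof -
  have xS: "x \<in> S" using x carr0_sub by auto
  define R where "R = (\<lambda>t. K x t / min 1 t) ` {0<..}"
  define N where "N = Sup R"
  have bdd: "bdd_above R"
    unfolding R_def using K_le_inter[of x] x
    by (intro bdd_aboveI2[of _ _ "qnorm (inter_space A0 A1) x"]) (auto simp: inter_carr divide_le_eq)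
  have KN: "K x t \<le> N * min 1 t" if "0 < t" for t
    using cSup_upper[OF _ bdd, of "K x t / min 1 t"] that by (auto simp: N_def R_def divide_le_eq)
  have K1: "0 \<le> K x 1" using K_nonneg[OF xS] by simp
  have N: "0 \<le> N" using KN[of 1] K1 by simp
  have "K x t \<le> (N powr (1 - \<eta>) * K x 1 powr \<eta>) * wt \<eta> t" if "0 < t" for t
  proof -
    have K0: "0 \<le> K x t" using K_nonneg[OF xS, of t] that by simp
    have "K x t = K x t powr (1 - \<eta>) * K x t powr \<eta>"
      using K0 \<eta> by (simp flip: powr_add)
    also have "\<dots> \<le> (N * min 1 t) powr (1 - \<eta>) * (max 1 t * K x 1) powr \<eta>"
      using KN[OF that] K_le_max[OF xS that] K0 \<eta> by (intro mult_mono powr_mono2) auto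
    also have "\<dots> = (N powr (1 - \<eta>) * K x 1 powr \<eta>) * wt \<eta> t"
      by (simp add: powr_mult wt_def mult_ac)
    finally show ?thesis .
  qed
  then have le: "K x t \<le> C * (N powr (1 - \<eta>) * K x 1 powr \<eta>) * min 1 t" if "0 < t" for t
    using CB that by blast
  have "N \<le> C * (N powr (1 - \<eta>) * K x 1 powr \<eta>)"
    unfolding N_def R_def
  proof (rule cSUP_least)
    fix t :: real assume "t \<in> {0<..}"
    then show "K x t / min 1 t \<le> C * (Sup ((\<lambda>t. K x t / min 1 t) ` {0<..}) powr (1 - \<eta>) * K x 1 powr \<eta>)"
      using le[of t] by (simp add: divide_le_eq N_def R_def)
  qed auto
  have "N \<le> C powr (1 / \<eta>) * K x 1"
  proof (cases "N = 0")
    case True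
    then show ?thesis using K1 by simp
  next
    case False
    with N have "0 < N" by simp
    have "N powr (1 - \<eta>) * N powr \<eta> \<le> N powr (1 - \<eta>) * (C * K x 1 powr \<eta>)"
      using \<open>N \<le> _\<close> \<open>0 < N\<close> by (simp add: mult_ac flip: powr_add)
    then have "N powr \<eta> \<le> C * K x 1 powr \<eta>"
      using \<open>0 < N\<close> by simp
    then have "(N powr \<eta>) powr (1 / \<eta>) \<le> (C * K x 1 powr \<eta>) powr (1 / \<eta>)"
      using \<eta> by (intro powr_mono2) auto
    then show ?thesis
      using \<eta> N K1 by (simp add: powr_powr powr_mult)
  qed
  then have "N * min 1 t \<le> C powr (1 / \<eta>) * K x 1 * min 1 t"
    using t by (intro mult_right_mono) auto
  with KN[OF t] have "K x t \<le> C powr (1 / \<eta>) * K x 1 * min 1 t"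
    by (rule order_trans)
  then show ?thesis by (simp only: mult_ac)
qed

section \<open>Closedness of the intersection\<close>

lemma limit_in_carr0:
  assumes y: "\<And>n. y n \<in> carr A0" and x: "x \<in> S" and lim: "(\<lambda>n. K (y n - x) 1) \<longlonglongrightarrow> 0"
    and f: "f \<longlonglongrightarrow> 0" and le: "\<And>m n. m \<le> n \<Longrightarrow> qnorm A0 (y n - y m) \<le> f m"
  shows "x \<in> carr A0"
proof -
  obtain a where a: "a \<in> carr A0" "(\<lambda>n. qnorm A0 (y n - a)) \<longlonglongrightarrow> 0"
    using quasi_banach_Cauchy_limit[OF banach0 y f le] by auto
  have d: "y n - a \<in> carr A0" for n
    using y a by (intro subspace_diff subspace0)
  have "x = a"
  proof (rule K_limit_unique[OF _ x _ lim])
    show "(\<lambda>n. K (y n - a) 1) \<longlonglongrightarrow> 0"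
    proof (rule tendsto_sandwich[OF _ _ tendsto_const a(2)])
      show "\<forall>\<^sub>F n in sequentially. 0 \<le> K (y n - a) 1"
        using d carr0_sub by (intro always_eventually allI K_nonneg) auto
      show "\<forall>\<^sub>F n in sequentially. K (y n - a) 1 \<le> qnorm A0 (y n - a)"
        using K_le_carr0[OF d] by simp
    qed
  qed (use y a carr0_sub in auto)
  with a show ?thesis by simp
qed

lemma limit_in_carr1:
  assumes y: "\<And>n. y n \<in> carr A1" and x: "x \<in> S" and lim: "(\<lambda>n. K (y n - x) 1) \<longlonglongrightarrow> 0"
    and f: "f \<longlonglongrightarrow> 0" and le: "\<And>m n. m \<le> n \<Longrightarrow> qnorm A1 (y n - y m) \<le> f m"
  shows "x \<in> carr A1"
proof -
  interpret sw: quasi_couple A1 A0 by (rule swap)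
  have "y n - x \<in> S" for n
    using y x carr1_sub by (intro subspace_diff subspace_S) auto
  then show ?thesis
    using sw.limit_in_carr0[OF y _ _ f le, of x] x lim by (simp add: K_swap sum_carr_swap)
qed

text \<open>Under these bounds a sequence of the intersection that converges in the sum is Cauchy in
  \<open>A0\<close> and in \<open>A1\<close>. Both limits coincide with the limit in the sum, which
  therefore lies in the intersection.\<close>

lemma closedin_inter:
  assumes M0: "\<And>x. x \<in> carr A0 \<inter> carr A1 \<Longrightarrow> qnorm A0 x \<le> M0 * K x 1"
    and M1: "\<And>x. x \<in> carr A0 \<inter> carr A1 \<Longrightarrow> qnorm A1 x \<le> M1 * K x 1"
  shows "closedin (qtop (sum_space A0 A1)) (carr (inter_space A0 A1))"
  unfolding closedin_def topspace_qtop openin_qtop inter_carr sum_qnorm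
proof (intro conjI ballI)
  show "carr A0 \<inter> carr A1 \<subseteq> S" using carr0_sub by auto
  fix x assume x: "x \<in> S - carr A0 \<inter> carr A1"
  show "\<exists>r>0. {y \<in> S. K (y - x) 1 < r} \<subseteq> S - carr A0 \<inter> carr A1"
  proof (rule ccontr)
    assume neg: "\<not> ?thesis"
    have "\<exists>y\<in>carr A0 \<inter> carr A1. K (y - x) 1 < 1 / real (Suc n)" for n
    proof -
      have "0 < 1 / real (Suc n)" by simp
      then show ?thesis using neg by blast
    qed
    then obtain y where y: "\<And>n. y n \<in> carr A0 \<inter> carr A1" and le: "\<And>n. K (y n - x) 1 < 1 / real (Suc n)"
      by metis
    obtain \<kappa> where p: "quasi_seminorm \<kappa> S (\<lambda>x. K x 1)"
      using K_quasi_seminorm by (metis zero_le_one)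
    have \<kappa>: "1 \<le> \<kappa>" by (rule quasi_seminorm_ge1[OF p])
    have xS: "x \<in> S" and yS: "y n \<in> S" for n
      using x y carr0_sub by auto
    have lim0: "(\<lambda>n. 1 / real (Suc n)) \<longlonglongrightarrow> 0"
      using LIMSEQ_inverse_real_of_nat by (simp add: inverse_eq_divide)
    have lim: "(\<lambda>n. K (y n - x) 1) \<longlonglongrightarrow> 0"
    proof (rule tendsto_sandwich[OF _ _ tendsto_const lim0])
      show "\<forall>\<^sub>F n in sequentially. 0 \<le> K (y n - x) 1"
        using xS yS by (intro always_eventually allI K_nonneg subspace_diff subspace_S) auto
      show "\<forall>\<^sub>F n in sequentially. K (y n - x) 1 \<le> 1 / real (Suc n)"
        using le by (intro always_eventually allI less_imp_le)
    qed
    have Cauchy: "K (y n - y m) 1 \<le> \<kappa> * (2 / real (Suc m))" if "m \<le> n" for m n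
    proof -
      have "K (y n - y m) 1 \<le> \<kappa> * (K (y n - x) 1 + K (y m - x) 1)"
        using quasi_seminorm_diff[OF p yS xS yS, of n m] quasi_seminorm_commute[OF p xS yS, of m] by simp
      also have "\<dots> \<le> \<kappa> * (1 / real (Suc n) + 1 / real (Suc m))"
        using \<kappa> le[of n] le[of m] by (intro mult_left_mono add_mono) auto
      also have "\<dots> \<le> \<kappa> * (1 / real (Suc m) + 1 / real (Suc m))"
        using \<kappa> that by (intro mult_left_mono add_mono divide_left_mono) auto
      finally show ?thesis by simp
    qed
    have diff: "y n - y m \<in> carr A0 \<inter> carr A1" for m n
      using y by (auto simp: subspace_diff subspace0 subspace1)
    \<comment> \<open>Absolute values, because the signs of \<open>M0\<close> and \<open>M1\<close>
      are unknown.\<close>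
    have f: "(\<lambda>m. \<bar>M\<bar> * (\<kappa> * (2 / real (Suc m)))) \<longlonglongrightarrow> 0" for M
      using tendsto_mult_right_zero[OF lim0, of "\<bar>M\<bar> * \<kappa> * 2"] by (simp add: mult_ac)
    have bnd: "M * K (y n - y m) 1 \<le> \<bar>M\<bar> * (\<kappa> * (2 / real (Suc m)))" if "m \<le> n" for m n M
      using Cauchy[OF that] K_nonneg[of "y n - y m" 1] diff[of n m] carr0_sub
      by (intro mult_mono) auto
    have "x \<in> carr A0"
    proof (rule limit_in_carr0[OF _ xS lim f[of M0]])
      show "y n \<in> carr A0" for n using y by blast
      show "qnorm A0 (y n - y m) \<le> \<bar>M0\<bar> * (\<kappa> * (2 / real (Suc m)))" if "m \<le> n" for m n
        by (rule order_trans[OF M0[OF diff] bnd[OF that]])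
    qed
    moreover have "x \<in> carr A1"
    proof (rule limit_in_carr1[OF _ xS lim f[of M1]])
      show "y n \<in> carr A1" for n using y by blast
      show "qnorm A1 (y n - y m) \<le> \<bar>M1\<bar> * (\<kappa> * (2 / real (Suc m)))" if "m \<le> n" for m n
        by (rule order_trans[OF M1[OF diff] bnd[OF that]])
    qed
    ultimately show False using x by auto
  qed
qed auto

text \<open>Statement (b) in contrapositive form. Equality places the class of
  \<open>wt \<eta>\<close> inside that of \<open>min 1\<close>; self-improvement of the resulting
  uniform bound yields the smallness of \<open>K\<close> that the approximation lemmas need on the
  intersection.\<close>

lemma interp_eq_inter_imp:
  assumes \<theta>: "0 < \<theta>" "\<theta> < 1" and q: "0 < q"
    and eq: "carr (interp_space A0 A1 \<theta> q) = carr (inter_space A0 A1)"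
  shows "closedin (qtop (sum_space A0 A1)) (carr (inter_space A0 A1))"
proof -
  let ?V = "carr A0 \<inter> carr A1"
  obtain \<kappa> where p0: "quasi_seminorm \<kappa> (carr A0) (qnorm A0)" and p1: "quasi_seminorm \<kappa> (carr A1) (qnorm A1)"
    by (rule K_quasi_seminorm)
  have \<kappa>: "1 \<le> \<kappa>" by (rule quasi_seminorm_ge1[OF p0])
  define \<epsilon> where "\<epsilon> = 1 / (4 * \<kappa>)"
  have \<epsilon>: "0 \<le> \<epsilon>" "0 < \<epsilon>" "4 * \<kappa> * \<epsilon> \<le> 1" using \<kappa> by (auto simp: \<epsilon>_def)
  \<comment> \<open>Strictly below \<open>\<theta>\<close> and \<open>1 - \<theta>\<close>, for
    finiteness of the interpolation norm; strictly positive, for the exponent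
    \<open>1 / \<eta>\<close> of the self-improvement.\<close>
  define \<eta> where "\<eta> = min \<theta> (1 - \<theta>) / 2"
  have \<eta>: "0 < \<eta>" "\<eta> < \<theta>" "\<eta> < 1 - \<theta>" "\<eta> < 1"
    using \<theta> by (auto simp: \<eta>_def min_def)
  obtain D where "0 < D" and D: "\<And>x B. x \<in> S \<Longrightarrow> (\<And>t. 0 < t \<Longrightarrow> K x t \<le> B * wt \<eta> t) \<Longrightarrow>
      interp_norm A0 A1 \<theta> q x \<le> ennreal (D * B)"
    by (rule interp_norm_le_of_K_le[OF \<eta>(2,3) q]) (rule that, auto)
  obtain C where C: "0 < C" and CB: "\<And>x B t. x \<in> S \<Longrightarrow> (\<And>t. 0 < t \<Longrightarrow> K x t \<le> B * wt \<eta> t) \<Longrightarrow> 0 < t \<Longrightarrow>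
      K x t \<le> C * B * min 1 t"
  proof (rule K_uniform_bound[of "wt \<eta>" "min 1"])
    fix x B assume "x \<in> S" "\<And>t. 0 < t \<Longrightarrow> K x t \<le> B * wt \<eta> t"
    then have "interp_norm A0 A1 \<theta> q x \<le> ennreal (D * B)" by (rule D)
    then have "x \<in> carr (inter_space A0 A1)"
      unfolding eq[symmetric] by (rule interp_carrI[OF \<open>x \<in> S\<close>])
    then show "\<exists>B'. \<forall>t>0. K x t \<le> B' * min 1 t"
      using K_le_inter by blast
  qed (auto simp: wt_pos)
  define C' where "C' = C powr (1 / \<eta>)"
  have C': "0 < C'" using C by (simp add: C'_def)
  have V: "?V \<subseteq> S" using carr0_sub by auto
  have bound: "K x t \<le> C' * min 1 t * K x 1" if "x \<in> ?V" "0 < t" for x t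
    unfolding C'_def using that V by (intro K_bound_self_improve[OF \<eta>(1,4) C that(1) CB]) auto
  \<comment> \<open>One \<open>t\<close> serves both ends: \<open>C' * t = \<epsilon>\<close> gives
    smallness at \<open>t\<close>, and \<open>C' = \<epsilon> * (1 / t)\<close> gives it at
    \<open>1 / t\<close>.\<close>
  define t where "t = \<epsilon> / C'"
  have t: "0 < t" using \<epsilon> C' by (simp add: t_def)
  have small1: "K x t \<le> \<epsilon> * K x 1" if "x \<in> ?V" for x
  proof -
    have "C' * min 1 t \<le> C' * t" using C' by (intro mult_left_mono) auto
    then have "C' * min 1 t \<le> \<epsilon>" using C' by (simp add: t_def)
    then show ?thesis
      using bound[OF that t] mult_right_mono[of "C' * min 1 t" \<epsilon> "K x 1"] K_nonneg[of x 1] that V by force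
  qed
  obtain M1 where M1: "\<And>x. x \<in> ?V \<Longrightarrow> x \<in> carr A1 \<and> qnorm A1 x \<le> M1 * K x 1"
  proof (rule approximable_imp_carr1[OF p1 V])
    show "x - a \<in> ?V" if "x \<in> ?V" "a \<in> carr A1" "x - a \<in> carr A0" for x a
      using that subspace_diff[OF subspace1] by blast
    show "0 < t" using t by simp
    show "K x t \<le> \<epsilon> * K x 1" if "x \<in> ?V" for x by (rule small1[OF that])
  qed (use \<epsilon> in auto)
  have small0: "K x (1 / t) \<le> \<epsilon> * (1 / t) * K x 1" if "x \<in> ?V" for x
  proof -
    have "C' * min 1 (1 / t) \<le> C' * 1" using C' by (intro mult_left_mono) auto
    also have "\<dots> = \<epsilon> * (1 / t)" using C' \<epsilon> by (simp add: t_def)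
    finally show ?thesis
      using bound[OF that, of "1 / t"] t mult_right_mono[of "C' * min 1 (1 / t)" "\<epsilon> * (1 / t)" "K x 1"]
        K_nonneg[of x 1] that V by force
  qed
  obtain M0 where M0: "\<And>x. x \<in> ?V \<Longrightarrow> x \<in> carr A0 \<and> qnorm A0 x \<le> M0 * K x 1"
  proof (rule approximable_imp_carr0[OF p0 V])
    show "x - a \<in> ?V" if "x \<in> ?V" "a \<in> carr A0" "x - a \<in> carr A1" for x a
      using that subspace_diff[OF subspace0] by blast
    show "0 < 1 / t" using t by simp
    show "K x (1 / t) \<le> \<epsilon> * (1 / t) * K x 1" if "x \<in> ?V" for x by (rule small0[OF that])
  qed (use \<epsilon> in auto)
  show ?thesis
    using M0 M1 by (intro closedin_inter) auto
qed

end

theorem corollary2p5: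
  fixes A0 A1 :: "'a::hausdorff_tvs qspace" and \<theta> :: real and q :: ennreal
  assumes "quasi_banach_couple A0 A1"
    and "0 < \<theta>" and "\<theta> < 1"
    and "0 < q"
  shows "inter_space A0 A1 \<hookrightarrow> interp_space A0 A1 \<theta> q \<and>
         interp_space A0 A1 \<theta> q \<hookrightarrow> sum_space A0 A1 \<and>
         (carr A0 \<noteq> carr (sum_space A0 A1) \<or> carr A1 \<noteq> carr (sum_space A0 A1) \<longrightarrow>
            carr (interp_space A0 A1 \<theta> q) \<noteq> carr (sum_space A0 A1)) \<and>
         (\<not> closedin (qtop (sum_space A0 A1)) (carr (inter_space A0 A1)) \<longrightarrow>
            carr (interp_space A0 A1 \<theta> q) \<noteq> carr (inter_space A0 A1))"
proof -
  interpret quasi_couple A0 A1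
    by unfold_locales (rule assms(1))
  show ?thesis
    using inter_included_interp interp_included_sum interp_eq_sum_imp interp_eq_inter_imp assms(2-4)
    by blast
qed

end
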